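(* Let $q$ be an odd power of the prime $p$ (i.e. $q=p^h$ odd), let $\mathcal{S}=\mathcal{Q}(4,q)$, let $U$ be any line of $\mathcal{S}$, and let $L=L_U$ be the group generated by all symmetries of $\mathcal{S}$ whose axis is contained in $U^\perp$. Let $u$ be a point on $U$ and $v$ a point not collinear with $u$, and let $H(L)=G(u,v)\cap L$, where $G(u,v)$ is the kernel of the translation generalized quadrangle $\mathcal{S}$ with translation point $u$ (with respect to $v$). Then $H(L)$ is (isomorphic to) a subgroup of $\mathbb{F}_p^{\times}$.
   Context: A symmetry about a line $M$ of a generalized quadrangle is an automorphism fixing every line concurrent with $M$ (including $M$); $U^\perp$ is the set of lines equal or concurrent to $U$. Every point $u$ of $\mathcal{Q}(4,q)$ is a translation point, and the kernel $G(u,v)$ is the group of automorphisms of $\mathcal{S}$ fixing every line through $u$ and every line through $v$. *)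

theory Defs
  imports "HOL-Analysis.Analysis" "HOL-Algebra.Bij" "HOL-Algebra.Generated_Groups" "HOL-Number_Theory.Residues"
begin

(* In a generalized quadrangle two points lie on at most one common line, so a line is
   identified with the set of points on it, and an automorphism is determined by its action
   on points.  A line l is fixed by f when f ` l = l (its points may move). *)

record 'p geometry =
  Points :: "'p set"
  Lines :: "'p set set"

definition collinear_in :: "('p, 'm) geometry_scheme \<Rightarrow> 'p \<Rightarrow> 'p \<Rightarrow> bool" where
  "collinear_in S x y \<longleftrightarrow> (\<exists>l\<in>Lines S. x \<in> l \<and> y \<in> l)"

definition line_perp :: "('p, 'm) geometry_scheme \<Rightarrow> 'p set \<Rightarrow> 'p set set" where
  "line_perp S U = {M \<in> Lines S. M = U \<or> M \<inter> U \<noteq> {}}"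

definition automorphisms :: "('p, 'm) geometry_scheme \<Rightarrow> ('p \<Rightarrow> 'p) set" where
  "automorphisms S = {f \<in> Bij (Points S). (\<lambda>l. f ` l) ` Lines S = Lines S}"

definition Aut_group :: "('p, 'm) geometry_scheme \<Rightarrow> ('p \<Rightarrow> 'p) monoid" where
  "Aut_group S = (BijGroup (Points S))\<lparr>carrier := automorphisms S\<rparr>"

definition symmetries :: "('p, 'm) geometry_scheme \<Rightarrow> 'p set \<Rightarrow> ('p \<Rightarrow> 'p) set" where
  "symmetries S M = {f \<in> automorphisms S. \<forall>l\<in>line_perp S M. f ` l = l}"

definition symmetry_group :: "('p, 'm) geometry_scheme \<Rightarrow> 'p set \<Rightarrow> ('p \<Rightarrow> 'p) set" where
  "symmetry_group S U = generate (Aut_group S) (\<Union>M\<in>line_perp S U. symmetries S M)"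

definition TGQ_kernel :: "('p, 'm) geometry_scheme \<Rightarrow> 'p \<Rightarrow> 'p \<Rightarrow> ('p \<Rightarrow> 'p) set" where
  "TGQ_kernel S u v = {f \<in> automorphisms S. \<forall>l\<in>Lines S. u \<in> l \<or> v \<in> l \<longrightarrow> f ` l = l}"

(* Q(4,q) in PG(4,q), where 'a is the field with q elements: the nonsingular parabolic quadric
   in its canonical form X0^2 + X1 X2 + X3 X4 = 0.  Coordinates are indexed by the
   five-element type 5, whose elements are 0, 1, 2, 3, 4. *)

definition parabolic_form :: "('a::field) ^ 5 \<Rightarrow> 'a" where
  "parabolic_form x = (x $ 0)\<^sup>2 + x $ 1 * x $ 2 + x $ 3 * x $ 4"

definition totally_singular :: "('a::field ^ 5) set \<Rightarrow> bool" where
  "totally_singular W \<longleftrightarrow> vec.subspace W \<and> (\<forall>x\<in>W. parabolic_form x = 0)"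

definition Q4_points :: "('a::field ^ 5) set set" where
  "Q4_points = {W. totally_singular W \<and> vec.dim W = 1}"

definition Q4 :: "('a::field ^ 5) set geometry" where
  "Q4 = \<lparr>Points = Q4_points,
         Lines = {{x \<in> Q4_points. x \<subseteq> W} | W. totally_singular W \<and> vec.dim W = 2}\<rparr>"

end

theory Submission
  imports Defs
begin

text \<open>The group \<open>H\<close> is in fact trivial. Symmetries about concurrent lines commute, and the symmetries
  about \<open>U\<close> commute with each other, being the Siegel transformations of the totally singular
  2-dimensional subspace underlying \<open>U\<close>; so \<open>L\<close> centralizes the symmetries about \<open>U\<close>. These act transitively on the points
  different from \<open>a\<close> of the line \<open>V\<close> through \<open>v\<close> that meets \<open>U\<close> in \<open>a\<close>. Hence an element of \<open>H\<close>, which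
  fixes every line through \<open>v\<close>, fixes every line meeting \<open>V\<close> in a point other than \<open>a\<close>; it also fixes
  a line through \<open>u\<close> disjoint from \<open>V\<close>, and this forces it to be the identity.\<close>

section \<open>Generalized quadrangles\<close>

text \<open>Commutation has two different sources. For two distinct concurrent axes it follows from
  incidence alone. For a single axis it comes from the quadric, where the Siegel transformations
  form an explicit one-parameter family. That this family contains every symmetry about
  \<open>U\<close> is again synthetic: a symmetry is determined by its image of one point off its
  axis, so a family of symmetries that is transitive on the relevant points leaves room for no
  others. The synthetic part therefore works with an arbitrary commuting, transitive set
  \<open>T\<close> of symmetries, and the linear algebra only has to supply \<open>T\<close>.
  Rigidity is formulated for two automorphisms \<open>f\<close> and \<open>g\<close> that agree, not
  for the fixed elements of one. Inverses then never enter, and the same results serve three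
  purposes: \<open>g\<close> the identity, two symmetries with the same axis, and the two products
  of a pair of symmetries.\<close>

locale gen_quad =
  fixes S :: "('p, 'm) geometry_scheme"
  assumes line_subset: "l \<in> Lines S \<Longrightarrow> l \<subseteq> Points S"
    and join_unique: "\<lbrakk>l \<in> Lines S; m \<in> Lines S; x \<in> l; y \<in> l; x \<in> m; y \<in> m; x \<noteq> y\<rbrakk> \<Longrightarrow> l = m"
    and proj_exists: "\<lbrakk>x \<in> Points S; l \<in> Lines S; x \<notin> l\<rbrakk> \<Longrightarrow> \<exists>y\<in>l. collinear_in S x y"
    and proj_unique: "\<lbrakk>l \<in> Lines S; x \<notin> l; y \<in> l; z \<in> l; collinear_in S x y; collinear_in S x z\<rbrakk> \<Longrightarrow> y = z"
    and third_point: "l \<in> Lines S \<Longrightarrow> \<exists>z\<in>l. z \<noteq> x \<and> z \<noteq> y"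
    and third_line: "x \<in> Points S \<Longrightarrow> \<exists>m\<in>Lines S. x \<in> m \<and> m \<noteq> k \<and> m \<noteq> l"
begin

abbreviation P where "P \<equiv> Points S"
abbreviation col where "col \<equiv> collinear_in S"

lemma col_sym: "col x y \<Longrightarrow> col y x"
  by (auto simp: collinear_in_def)

lemma colI: "l \<in> Lines S \<Longrightarrow> x \<in> l \<Longrightarrow> y \<in> l \<Longrightarrow> col x y"
  by (auto simp: collinear_in_def)

section \<open>Automorphisms and the group they form\<close>

lemma aut_inj: "f \<in> automorphisms S \<Longrightarrow> inj_on f P"
  by (auto simp: automorphisms_def Bij_def bij_betw_def)

lemma aut_image_points: "f \<in> automorphisms S \<Longrightarrow> f ` P = P"
  by (auto simp: automorphisms_def Bij_def bij_betw_def)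

lemma aut_point: "f \<in> automorphisms S \<Longrightarrow> x \<in> P \<Longrightarrow> f x \<in> P"
  using aut_image_points by blast

lemma aut_line: "f \<in> automorphisms S \<Longrightarrow> l \<in> Lines S \<Longrightarrow> f ` l \<in> Lines S"
  by (auto simp: automorphisms_def)

lemma aut_col: "f \<in> automorphisms S \<Longrightarrow> col x y \<Longrightarrow> col (f x) (f y)"
  unfolding collinear_in_def using aut_line by blast

lemma aut_image_mem:
  "f \<in> automorphisms S \<Longrightarrow> l \<in> Lines S \<Longrightarrow> x \<in> P \<Longrightarrow> f x \<in> f ` l \<longleftrightarrow> x \<in> l"
  by (meson aut_inj inj_on_image_mem_iff line_subset)

lemma aut_image_line_eq:
  "f \<in> automorphisms S \<Longrightarrow> l \<in> Lines S \<Longrightarrow> m \<in> Lines S \<Longrightarrow> f ` l = f ` m \<longleftrightarrow> l = m"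
  by (meson aut_inj inj_on_image_eq_iff line_subset)

lemma aut_bij: "f \<in> automorphisms S \<Longrightarrow> f \<in> Bij P"
  by (simp add: automorphisms_def)

lemma compose_image: "l \<subseteq> P \<Longrightarrow> compose P f g ` l = f ` g ` l"
  by (auto simp: compose_def image_iff)

lemma aut_compose:
  assumes "f \<in> automorphisms S" "g \<in> automorphisms S"
  shows "compose P f g \<in> automorphisms S"
proof -
  have "(\<lambda>l. compose P f g ` l) ` Lines S = (\<lambda>l. f ` l) ` (\<lambda>l. g ` l) ` Lines S"
    unfolding image_image[of "\<lambda>l. f ` l"] by (intro image_cong compose_image line_subset refl)
  then show ?thesis
    using assms by (simp add: automorphisms_def compose_Bij)
qed

lemma subgroup_automorphisms: "subgroup (automorphisms S) (BijGroup P)"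
proof (rule group.subgroupI[OF group_BijGroup])
  show "automorphisms S \<subseteq> carrier (BijGroup P)"
    by (auto simp: automorphisms_def BijGroup_def)
  have "(\<lambda>l. (\<lambda>x\<in>P. x) ` l) ` Lines S = (\<lambda>l. l) ` Lines S"
    using line_subset by (intro image_cong) (auto simp: subset_iff)
  then have "(\<lambda>x\<in>P. x) \<in> automorphisms S"
    by (simp add: automorphisms_def id_Bij)
  then show "automorphisms S \<noteq> {}" by blast
  show "f \<otimes>\<^bsub>BijGroup P\<^esub> g \<in> automorphisms S"
    if "f \<in> automorphisms S" "g \<in> automorphisms S" for f g
    using that aut_compose aut_bij by (simp add: BijGroup_def)
  show "inv\<^bsub>BijGroup P\<^esub> f \<in> automorphisms S" if f: "f \<in> automorphisms S" for f
  proof -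
    let ?g = "\<lambda>x\<in>P. inv_into P f x"
    have img: "?g ` f ` l = l" if l: "l \<in> Lines S" for l
    proof -
      have "?g (f x) = x" if "x \<in> l" for x
        using line_subset[OF l] that aut_inj[OF f] aut_point[OF f] by (auto simp: inv_into_f_f)
      then have "?g ` f ` l = (\<lambda>x. x) ` l"
        unfolding image_image by (intro image_cong refl)
      then show ?thesis by simp
    qed
    have "(\<lambda>l. f ` l) ` Lines S = Lines S"
      using f by (simp add: automorphisms_def)
    then have "(\<lambda>l. ?g ` l) ` Lines S = (\<lambda>l. ?g ` l) ` (\<lambda>l. f ` l) ` Lines S"
      by (rule arg_cong[OF sym])
    also have "\<dots> = (\<lambda>l. l) ` Lines S"
      unfolding image_image[of "\<lambda>l. ?g ` l"] by (intro image_cong img refl)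
    finally show ?thesis
      unfolding automorphisms_def inv_BijGroup[OF aut_bij[OF f]]
      using restrict_inv_into_Bij[OF aut_bij[OF f]] by auto
  qed
qed

lemma group_Aut_group: "group (Aut_group S)"
  unfolding Aut_group_def
  by (rule subgroup.subgroup_is_group[OF subgroup_automorphisms group_BijGroup])

lemma Aut_group_simps:
  "carrier (Aut_group S) = automorphisms S"
  "\<one>\<^bsub>Aut_group S\<^esub> = (\<lambda>x\<in>P. x)"
  "f \<in> automorphisms S \<Longrightarrow> g \<in> automorphisms S \<Longrightarrow> f \<otimes>\<^bsub>Aut_group S\<^esub> g = compose P f g"
  by (simp_all add: Aut_group_def BijGroup_def aut_bij)

section \<open>Criteria for two automorphisms to agree\<close>

lemma agree_line:
  assumes "f \<in> automorphisms S" "g \<in> automorphisms S" "l \<in> Lines S"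
    and "x \<in> l" "y \<in> l" "x \<noteq> y" "f x = g x" "f y = g y"
  shows "f ` l = g ` l"
proof -
  have "f x \<noteq> f y"
    using assms aut_inj line_subset by (meson inj_onD subsetD)
  then show ?thesis
    using assms aut_line join_unique[of "f ` l" "g ` l" "f x" "f y"] by (metis imageI)
qed

lemma agree_meet:
  assumes "f \<in> automorphisms S" "g \<in> automorphisms S" "l \<in> Lines S" "m \<in> Lines S" "l \<noteq> m"
    and "x \<in> l" "x \<in> m" "f ` l = g ` l" "f ` m = g ` m"
  shows "f x = g x"
  using assms aut_line aut_image_line_eq join_unique[of "f ` l" "f ` m" "f x" "g x"]
  by (metis imageI)

text \<open>The point of \<open>l\<close> collinear with a point off \<open>l\<close> is unique, and
  automorphisms preserve this projection.\<close>

lemma agree_proj: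
  assumes "f \<in> automorphisms S" "g \<in> automorphisms S" "l \<in> Lines S"
    and "f ` l = g ` l" "x \<in> P" "x \<notin> l" "f x = g x" "y \<in> l" "col x y"
  shows "f y = g y"
proof (rule proj_unique[of "f ` l" "f x"])
  show "f ` l \<in> Lines S" "f x \<notin> f ` l" "f y \<in> f ` l" "g y \<in> f ` l"
    using assms aut_line aut_image_mem by auto
  show "col (f x) (f y)"
    using assms(1,9) by (rule aut_col)
  show "col (f x) (g y)"
    using aut_col[OF assms(2,9)] assms(7) by simp
qed

text \<open>A line missing \<open>e\<close> has exactly one point collinear with \<open>e\<close>,
  so at least two of its points lie in the region of agreement and determine its image. A point
  other than \<open>e\<close> that is collinear with \<open>e\<close> is then the intersection of
  two such lines.\<close>

lemma agree_off_perp: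
  assumes f: "f \<in> automorphisms S" and g: "g \<in> automorphisms S" and e: "e \<in> P"
    and off: "\<And>x. x \<in> P \<Longrightarrow> \<not> col x e \<Longrightarrow> f x = g x" and x: "x \<in> P"
  shows "f x = g x"
proof -
  have line: "f ` l = g ` l" if l: "l \<in> Lines S" "z \<in> l" "e \<notin> l" "col z e" for l z
  proof -
    obtain a where a: "a \<in> l" "a \<noteq> z" using third_point[OF l(1)] by blast
    obtain b where b: "b \<in> l" "b \<noteq> z" "b \<noteq> a" using third_point[OF l(1)] by blast
    have "\<not> col c e" if "c \<in> l" "c \<noteq> z" for c
      using proj_unique[of l e c z] l that col_sym by blast
    then have "f a = g a" "f b = g b"
      using a b off l line_subset by blast+
    then show ?thesis
      using agree_line[OF f g l(1)] a b by metis
  qed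
  have other: "f z = g z" if z: "z \<in> P" "z \<noteq> e" for z
  proof (cases "col z e")
    case True
    then obtain m where m: "m \<in> Lines S" "z \<in> m" "e \<in> m"
      by (auto simp: collinear_in_def)
    obtain l where l: "l \<in> Lines S" "z \<in> l" "l \<noteq> m" using third_line[OF z(1)] by blast
    obtain k where k: "k \<in> Lines S" "z \<in> k" "k \<noteq> m" "k \<noteq> l" using third_line[OF z(1)] by blast
    have "e \<notin> l" "e \<notin> k"
      using join_unique m l k z(2) by blast+
    then have "f ` l = g ` l" "f ` k = g ` k"
      using line True l k by auto
    then show ?thesis
      using agree_meet f g l k by metis
  qed (use off z in auto)
  show ?thesis
  proof (cases "x = e")
    case True
    \<comment> \<open>Only \<open>e\<close> is left. If \<open>g\<close> took the value
      \<open>f e\<close> at some \<open>w\<close> other than \<open>e\<close>, then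
      \<open>f w = f e\<close>, against injectivity.\<close>
    obtain w where w: "w \<in> P" "g w = f e"
      using aut_image_points[OF g] aut_point[OF f e] by (metis imageE)
    have "w = e"
      using other[OF w(1)] w e aut_inj[OF f] by (metis inj_onD)
    then show ?thesis using w True by simp
  qed (use other x in auto)
qed

text \<open>In the language of one automorphism: its fixed elements would form a full subquadrangle.\<close>

lemma agree_on_line_pencil:
  assumes f: "f \<in> automorphisms S" and g: "g \<in> automorphisms S"
    and M: "M \<in> Lines S" and N: "N \<in> Lines S" and disj: "M \<inter> N = {}" and e: "e \<in> M"
    and pencil: "\<And>l x. l \<in> Lines S \<Longrightarrow> x \<in> l \<Longrightarrow> x \<in> M \<Longrightarrow> x \<noteq> e \<Longrightarrow> f ` l = g ` l"
    and fN: "f ` N = g ` N" and x: "x \<in> P"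
  shows "f x = g x"
proof -
  have MP: "M \<subseteq> P" and NP: "N \<subseteq> P" using line_subset M N by auto
  \<comment> \<open>The line joining \<open>y\<close> to its projection on \<open>M\<close> meets
    \<open>M\<close> away from \<open>e\<close>, and \<open>y\<close> is its intersection with
    \<open>N\<close>.\<close>
  have onN: "f y = g y" if y: "y \<in> N" "\<not> col y e" for y
  proof -
    obtain a where a: "a \<in> M" "col y a" using proj_exists[of y M] y disj M NP by blast
    then obtain l where l: "l \<in> Lines S" "y \<in> l" "a \<in> l" by (auto simp: collinear_in_def)
    have "f ` l = g ` l" using pencil[OF l(1,3) a(1)] a y by metis
    moreover have "l \<noteq> N" using l a disj by blast
    ultimately show ?thesis using agree_meet[OF f g l(1) N] l y fN by metis
  qed
  \<comment> \<open>At most one point of \<open>N\<close> is collinear with \<open>e\<close>. Since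
    \<open>f\<close> and \<open>g\<close> map \<open>N\<close> onto the same line and agree at its
    other points, they agree there too.\<close>
  have onN': "f y = g y" if y: "y \<in> N" for y
  proof (cases "col y e")
    case True
    have neq: "\<not> col z e" if "z \<in> N" "z \<noteq> y" for z
      using proj_unique[of N e z y] N that y True disj e col_sym by blast
    have "g y \<in> f ` N" using y fN by auto
    then obtain w where w: "w \<in> N" "g y = f w" by auto
    have "w = y"
    proof (rule ccontr)
      assume "w \<noteq> y"
      then have "f w = g w" using onN neq w by metis
      then show False using w y NP aut_inj[OF g] \<open>w \<noteq> y\<close> by (metis inj_onD subsetD)
    qed
    then show ?thesis using w by simp
  qed (use onN y in auto)
  \<comment> \<open>Every point of \<open>C\<close> is the projection onto \<open>C\<close> of some
    point of \<open>N\<close>, where agreement is known.\<close>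
  have disjoint_line: "f c = g c"
    if C: "C \<in> Lines S" "a \<in> C" "a \<in> M" "a \<noteq> e" "C \<inter> N = {}" "c \<in> C" for C a c
  proof -
    obtain y where y: "y \<in> N" "col c y"
      using proj_exists[of c N] line_subset C N by blast
    have fC: "f ` C = g ` C" using pencil C by blast
    show ?thesis
      using agree_proj[OF f g C(1) fC, of y c] y C NP onN' col_sym by blast
  qed
  \<comment> \<open>Here \<open>C\<close> may meet \<open>N\<close>, so an auxiliary line
    \<open>D\<close> through a third point \<open>b\<close> of \<open>M\<close> replaces
    \<open>N\<close>. Avoiding the line \<open>k\<close> that joins \<open>b\<close> to
    \<open>N\<close> makes \<open>D\<close> disjoint from \<open>N\<close>, and a common point of
    \<open>D\<close> and \<open>C\<close> would form a triangle with \<open>a\<close> and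
    \<open>b\<close>. Agreement on \<open>D\<close> is thus already known and projects onto
    \<open>C\<close>.\<close>
  have meeting_line: "f c = g c"
    if C: "C \<in> Lines S" "a \<in> C" "a \<in> M" "a \<noteq> e" "c \<in> C" "C \<noteq> M" for C a c
  proof -
    obtain b where b: "b \<in> M" "b \<noteq> e" "b \<noteq> a" using third_point[OF M] by blast
    have bP: "b \<in> P" using b MP by blast
    have bN: "b \<notin> N" using b disj by blast
    obtain n where n: "n \<in> N" "col b n" using proj_exists[OF bP N bN] by blast
    then obtain k where k: "k \<in> Lines S" "b \<in> k" "n \<in> k" by (auto simp: collinear_in_def)
    obtain D where D: "D \<in> Lines S" "b \<in> D" "D \<noteq> M" "D \<noteq> k" using third_line[OF bP] by blast
    have DN: "D \<inter> N = {}"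
    proof (rule ccontr)
      assume "D \<inter> N \<noteq> {}"
      then obtain d where d: "d \<in> D" "d \<in> N" by blast
      then have "d = n" using proj_unique[OF N bN] n colI[OF D(1,2)] by blast
      then show False using join_unique[OF D(1) k(1), of b n] d D k n bN by blast
    qed
    have DC: "D \<inter> C = {}"
    proof (rule ccontr)
      assume "D \<inter> C \<noteq> {}"
      then obtain d where d: "d \<in> D" "d \<in> C" by blast
      have dM: "d \<notin> M"
        using join_unique[OF D(1) M, of b d] join_unique[OF C(1) M, of a d] d b D C by blast
      show False
        using proj_unique[OF M dM b(1) C(3)] colI[OF D(1) d(1) D(2)] colI[OF C(1) d(2) C(2)] b by blast
    qed
    have cD: "c \<notin> D" using DC C by blast
    obtain d where d: "d \<in> D" "col c d"
      using proj_exists[of c D] line_subset C D cD by blast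
    have "f d = g d" using disjoint_line[OF D(1,2) b(1,2) DN d(1)] .
    moreover have "f ` C = g ` C" using pencil C by blast
    moreover have "d \<notin> C" "d \<in> P" using d DC D line_subset by blast+
    ultimately show ?thesis
      using agree_proj[OF f g C(1), of d c] C d col_sym by blast
  qed
  have "f z = g z" if z: "z \<in> P" "\<not> col z e" for z
  proof -
    have zM: "z \<notin> M" using z e M colI by blast
    obtain a where a: "a \<in> M" "col z a" using proj_exists[OF z(1) M zM] by blast
    then obtain C where C: "C \<in> Lines S" "z \<in> C" "a \<in> C" by (auto simp: collinear_in_def)
    show ?thesis
      using meeting_line[OF C(1,3) a(1) _ C(2)] a z C zM by metis
  qed
  then show ?thesis
    using agree_off_perp[OF f g _ _ x] e MP by blast
qed

section \<open>Symmetries about a line\<close>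

lemma symmetriesD:
  assumes "s \<in> symmetries S M"
  shows "s \<in> automorphisms S" "l \<in> Lines S \<Longrightarrow> M \<in> Lines S \<Longrightarrow> x \<in> l \<Longrightarrow> x \<in> M \<Longrightarrow> s ` l = l"
  using assms by (auto simp: symmetries_def line_perp_def)

text \<open>The point is the intersection of the axis with another line through it, and both lines
  are fixed.\<close>

lemma symmetry_fixes_axis_points:
  assumes s: "s \<in> symmetries S M" and M: "M \<in> Lines S" and x: "x \<in> M"
  shows "s x = x"
proof -
  have xP: "x \<in> P" using line_subset M x by blast
  obtain l where l: "l \<in> Lines S" "x \<in> l" "l \<noteq> M" using third_line[OF xP] by blast
  show ?thesis
    using join_unique[OF l(1) M, of "s x" x] l x symmetriesD(2)[OF s l(1) M l(2) x]
      symmetriesD(2)[OF s M M x x] by blast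
qed

lemma automorphisms_agree_ext:
  assumes "f \<in> automorphisms S" "g \<in> automorphisms S" "\<And>x. x \<in> P \<Longrightarrow> f x = g x"
  shows "f = g"
  using assms by (intro extensionalityI[of f P]) (auto simp: automorphisms_def Bij_def)

text \<open>Both maps fix all lines meeting \<open>U\<close>. Agreement at \<open>v\<close> spreads
  along such lines to a second point of a line \<open>N\<close> through \<open>v\<close> that misses
  \<open>U\<close>; then \<open>agree_on_line_pencil\<close> applies to \<open>U\<close> and
  \<open>N\<close>.\<close>

lemma symmetry_determined:
  assumes s: "s \<in> symmetries S U" and t: "t \<in> symmetries S U" and U: "U \<in> Lines S"
    and v: "v \<in> P" "v \<notin> U" and eq: "s v = t v"
  shows "s = t"
proof -
  note sa = symmetriesD(1)[OF s] and ta = symmetriesD(1)[OF t]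
  obtain a where a: "a \<in> U" "col v a" using proj_exists[OF v(1) U v(2)] by blast
  then obtain V where V: "V \<in> Lines S" "v \<in> V" "a \<in> V" by (auto simp: collinear_in_def)
  \<comment> \<open>\<open>v\<close> has only one projection on \<open>U\<close>, so a line through
    \<open>v\<close> other than \<open>V\<close> misses \<open>U\<close>.\<close>
  obtain N where N: "N \<in> Lines S" "v \<in> N" "N \<noteq> V" using third_line[OF v(1)] by blast
  have UN: "U \<inter> N = {}"
    using proj_unique[OF U v(2) a(1) _ a(2)] colI[OF N(1,2)] join_unique[OF N(1) V(1), of v a] N V a v
    by blast
  obtain w where w: "w \<in> N" "w \<noteq> v" using third_point[OF N(1)] by blast
  have wP: "w \<in> P" and wU: "w \<notin> U" using w N line_subset UN by blast+
  obtain b where b: "b \<in> U" "col w b" using proj_exists[OF wP U wU] by blast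
  then obtain C where C: "C \<in> Lines S" "w \<in> C" "b \<in> C" by (auto simp: collinear_in_def)
  have vC: "v \<notin> C" using join_unique[OF C(1) N(1), of v w] C w N UN b by blast
  \<comment> \<open>\<open>w\<close> is the projection of \<open>v\<close> onto \<open>C\<close>,
    and \<open>C\<close> is fixed by both maps because it meets \<open>U\<close>.\<close>
  have "s w = t w"
  proof (rule agree_proj[OF sa ta C(1) _ v(1) vC eq C(2)])
    show "s ` C = t ` C"
      using symmetriesD(2)[OF s C(1) U C(3) b(1)] symmetriesD(2)[OF t C(1) U C(3) b(1)] by simp
    show "col v w" using colI N w by blast
  qed
  then have sN: "s ` N = t ` N"
    using agree_line[OF sa ta N(1)] eq N w by metis
  show ?thesis
  proof (rule automorphisms_agree_ext[OF sa ta])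
    fix x assume "x \<in> P"
    then show "s x = t x"
      using symmetriesD(2)[OF s _ U] symmetriesD(2)[OF t _ U]
      by (intro agree_on_line_pencil[OF sa ta U N(1) UN a(1) _ sN]) auto
  qed
qed

text \<open>For \<open>y\<close> not collinear with \<open>e\<close>, let \<open>A\<close> and
  \<open>B\<close> join \<open>y\<close> to its projections on \<open>M\<close> and
  \<open>U\<close>. The symmetry \<open>s\<close> fixes every line meeting \<open>M\<close>, in
  particular \<open>A\<close> and \<open>t\<close>
  A\<open>; likewise\<close>t\<open>fixes\<close>B\<open>and\<close>s \<open>B\<close>. Both
  products therefore send \<open>y\<close> to the intersection of \<open>s\<close>
  B\<open>and\<close>t \<open>A\<close>.\<close>

lemma concurrent_symmetries_commute:
  assumes s: "s \<in> symmetries S M" and t: "t \<in> symmetries S U"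
    and M: "M \<in> Lines S" and U: "U \<in> Lines S" and neq: "M \<noteq> U" and e: "e \<in> M" "e \<in> U"
    and x: "x \<in> P"
  shows "s (t x) = t (s x)"
proof -
  note sa = symmetriesD(1)[OF s] and ta = symmetriesD(1)[OF t]
  have sU: "s ` U = U" and tM: "t ` M = M"
    using symmetriesD(2)[OF s U M e(2,1)] symmetriesD(2)[OF t M U e] by auto
  have oP: "e \<in> P" using e M line_subset by blast
  have s_o: "s e = e" and t_o: "t e = e"
    using symmetry_fixes_axis_points s t M U e by auto
  have cs: "compose P s t \<in> automorphisms S" "compose P t s \<in> automorphisms S"
    using aut_compose sa ta by auto
  have "compose P s t x = compose P t s x"
  proof (rule agree_off_perp[OF cs oP _ x])
    fix y assume y: "y \<in> P" "\<not> col y e"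
    have yM: "y \<notin> M" and yU: "y \<notin> U" using y e M U colI by blast+
    obtain a where a: "a \<in> M" "col y a" using proj_exists[OF y(1) M yM] by blast
    then obtain A where A: "A \<in> Lines S" "y \<in> A" "a \<in> A" by (auto simp: collinear_in_def)
    obtain b where b: "b \<in> U" "col y b" using proj_exists[OF y(1) U yU] by blast
    then obtain B where B: "B \<in> Lines S" "y \<in> B" "b \<in> B" by (auto simp: collinear_in_def)
    have aP: "a \<in> P" and bP: "b \<in> P" using a b M U line_subset by auto
    have sb: "s b \<in> U" "s b \<noteq> e" and ta': "t a \<in> M" "t a \<noteq> e"
      using a b sU tM s_o t_o y aut_inj[OF sa] aut_inj[OF ta] aP bP oP by (auto dest: inj_onD)
    have sB: "s ` B \<in> Lines S" "t ` s ` B = s ` B" "s ` t ` B = s ` B"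
      using aut_line[OF sa B(1)] symmetriesD(2)[OF t _ U, of "s ` B" "s b"] sb B
        symmetriesD(2)[OF t B(1) U B(3) b(1)] by auto
    have tA: "t ` A \<in> Lines S" "s ` t ` A = t ` A" "t ` s ` A = t ` A"
      using aut_line[OF ta A(1)] symmetriesD(2)[OF s _ M, of "t ` A" "t a"] ta' A
        symmetriesD(2)[OF s A(1) M A(3) a(1)] by auto
    \<comment> \<open>If they coincided, this line would miss \<open>e\<close> but contain
      \<open>s b\<close> on \<open>U\<close> and \<open>t a\<close> on \<open>M\<close>, both
      collinear with \<open>e\<close>. These would be one point other than \<open>e\<close> common
      to \<open>M\<close> and \<open>U\<close>.\<close>
    have "s ` B \<noteq> t ` A"
    proof
      assume eq: "s ` B = t ` A"
      have mem: "s b \<in> s ` B" "t a \<in> s ` B" using B A eq by auto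
      have oB: "e \<notin> s ` B"
        using aut_image_mem[OF sa B(1) oP] s_o colI[OF B(1,2)] y by auto
      show False
        using proj_unique[OF sB(1) oB mem] colI[OF U e(2) sb(1)] colI[OF M e(1) ta'(1)]
          join_unique[OF M U, of e "s b"] sb ta' e neq by metis
    qed
    moreover have "s (t y) \<in> s ` B" "t (s y) \<in> s ` B" "s (t y) \<in> t ` A" "t (s y) \<in> t ` A"
      using sB tA A B by blast+
    ultimately show "compose P s t y = compose P t s y"
      using join_unique[OF sB(1) tA(1)] y by (auto simp: compose_def)
  qed
  then show ?thesis using x by (simp add: compose_def)
qed

section \<open>The kernel against the centralizer of a transitive family of symmetries\<close>

lemma kernel_commuting_with_transitive_symmetries:
  assumes U: "U \<in> Lines S" and u: "u \<in> U" and v: "v \<in> P" "\<not> col u v"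
    and T: "T \<subseteq> symmetries S U"
    and trans: "\<And>V a x y. \<lbrakk>V \<in> Lines S; V \<noteq> U; a \<in> V; a \<in> U; x \<in> V; y \<in> V; x \<noteq> a; y \<noteq> a\<rbrakk>
      \<Longrightarrow> \<exists>t\<in>T. t x = y"
    and f: "f \<in> TGQ_kernel S u v"
    and comm: "\<And>t x. t \<in> T \<Longrightarrow> x \<in> P \<Longrightarrow> f (t x) = t (f x)"
  shows "f = \<one>\<^bsub>Aut_group S\<^esub>"
proof -
  let ?id = "\<lambda>x\<in>P. x"
  have fa: "f \<in> automorphisms S"
    and fl: "\<And>l. l \<in> Lines S \<Longrightarrow> u \<in> l \<or> v \<in> l \<Longrightarrow> f ` l = l"
    using f by (auto simp: TGQ_kernel_def)
  have ida: "?id \<in> automorphisms S"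
    using group.is_monoid[OF group_Aut_group, THEN monoid.one_closed] by (simp add: Aut_group_simps)
  have id_image: "?id ` l = l" if "l \<in> Lines S" for l
    using line_subset[OF that] by (auto simp: subset_iff)
  have vU: "v \<notin> U" using U u v colI by blast
  have uP: "u \<in> P" using U u line_subset by blast
  obtain a where a: "a \<in> U" "col v a" using proj_exists[OF v(1) U vU] by blast
  then obtain V where V: "V \<in> Lines S" "v \<in> V" "a \<in> V" by (auto simp: collinear_in_def)
  have VU: "V \<noteq> U" and va: "v \<noteq> a" using V vU a by auto
  have uV: "u \<notin> V" using v V colI by blast
  \<comment> \<open>\<open>u\<close> projects onto \<open>V\<close> at \<open>a\<close>, along
    \<open>U\<close>; any other line through \<open>u\<close> therefore misses
    \<open>V\<close>.\<close>
  obtain N where N: "N \<in> Lines S" "u \<in> N" "N \<noteq> U" using third_line[OF uP] by blast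
  have "u \<noteq> a" using uV V by blast
  then have aN: "a \<notin> N" using join_unique[OF N(1) U N(2) _ u a(1)] N(3) by blast
  have "z \<notin> N" if "z \<in> V" for z
    using proj_unique[OF V(1) uV V(3) that colI[OF U u a(1)]] colI[OF N(1,2)] aN by auto
  then have VN: "V \<inter> N = {}" by blast
  obtain l where l: "l \<in> Lines S" "v \<in> l" "l \<noteq> V" using third_line[OF v(1)] by blast
  have "f v \<in> l" "f v \<in> V" using fl[OF l(1)] fl[OF V(1)] l V by blast+
  then have fv: "f v = v"
    using join_unique[OF l(1) V(1), of "f v" v] l V by auto
  have fpencil: "f ` m = m" if m: "m \<in> Lines S" "w \<in> m" "w \<in> V" "w \<noteq> a" for m w
  proof -
    obtain t where t: "t \<in> T" "t v = w" using trans[OF V(1) VU V(3) a(1) V(2) m(3) va m(4)] by blast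
    have ta: "t \<in> automorphisms S" using T t symmetriesD(1) by blast
    have "m \<in> (\<lambda>k. t ` k) ` Lines S" using m(1) ta by (simp add: automorphisms_def)
    then obtain k where k: "k \<in> Lines S" "t ` k = m" by auto
    have "v \<in> k" using aut_image_mem[OF ta k(1) v(1)] t k m by simp
    \<comment> \<open>\<open>t\<close> carries the line \<open>k\<close> through \<open>v\<close> to
      \<open>m\<close>, so commutation transports the fixing of \<open>k\<close> to
      \<open>m\<close>.\<close>
    have "f ` m = (\<lambda>x. f (t x)) ` k" unfolding k(2)[symmetric] by (simp add: image_image)
    also have "\<dots> = (\<lambda>x. t (f x)) ` k"
      using comm[OF t(1)] line_subset[OF k(1)] by (intro image_cong) auto
    also have "\<dots> = t ` f ` k" by (simp add: image_image)
    also have "\<dots> = m" using fl[OF k(1)] \<open>v \<in> k\<close> k by simp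
    finally show ?thesis .
  qed
  have "f = ?id"
  proof (rule automorphisms_agree_ext[OF fa ida])
    fix x assume x: "x \<in> P"
    show "f x = ?id x"
    proof (rule agree_on_line_pencil[OF fa ida V(1) N(1) VN V(3) _ _ x])
      show "f ` l = ?id ` l" if "l \<in> Lines S" "x \<in> l" "x \<in> V" "x \<noteq> a" for l x
        using fpencil that id_image by simp
      show "f ` N = ?id ` N" using fl[OF N(1)] N id_image by simp
    qed
  qed
  then show ?thesis by (simp add: Aut_group_simps)
qed

theorem kernel_Int_symmetry_group:
  assumes U: "U \<in> Lines S" and u: "u \<in> U" and v: "v \<in> P" "\<not> col u v"
    and T: "T \<subseteq> symmetries S U"
    and abel: "\<And>s t x. s \<in> T \<Longrightarrow> t \<in> T \<Longrightarrow> x \<in> P \<Longrightarrow> s (t x) = t (s x)"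
    and trans: "\<And>V a x y. \<lbrakk>V \<in> Lines S; V \<noteq> U; a \<in> V; a \<in> U; x \<in> V; y \<in> V; x \<noteq> a; y \<noteq> a\<rbrakk>
      \<Longrightarrow> \<exists>t\<in>T. t x = y"
  shows "TGQ_kernel S u v \<inter> symmetry_group S U = {\<one>\<^bsub>Aut_group S\<^esub>}"
proof -
  let ?G = "Aut_group S"
  interpret G: group ?G by (rule group_Aut_group)
  let ?X = "\<Union>M\<in>line_perp S U. symmetries S M"
  have X: "?X \<subseteq> carrier ?G" unfolding Aut_group_simps by (auto simp: symmetries_def)
  have Tc: "T \<subseteq> carrier ?G" using T unfolding Aut_group_simps by (auto simp: symmetries_def)
  have vU: "v \<notin> U" using U u v colI by blast
  \<comment> \<open>A symmetry about \<open>U\<close> moves \<open>v\<close> to a point of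
    \<open>V\<close> other than \<open>a\<close>. Some element of \<open>T\<close> does the same,
    and equals it by \<open>symmetry_determined\<close>.\<close>
  have sym_T: "symmetries S U \<subseteq> T"
  proof
    fix s assume s: "s \<in> symmetries S U"
    obtain a where a: "a \<in> U" "col v a" using proj_exists[OF v(1) U vU] by blast
    then obtain V where V: "V \<in> Lines S" "v \<in> V" "a \<in> V" by (auto simp: collinear_in_def)
    have "s ` V = V" using symmetriesD(2)[OF s V(1) U V(3) a(1)] .
    then have "s v \<in> V" using V by blast
    moreover have "s v \<noteq> a"
      using symmetry_fixes_axis_points[OF s U a(1)] aut_inj[OF symmetriesD(1)[OF s]] v vU a
        line_subset[OF U] by (metis inj_onD subsetD)
    ultimately obtain t where t: "t \<in> T" "t v = s v"
      using trans[OF V(1) _ V(3) a(1) V(2), of "s v"] V vU a by blast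
    then have "s = t" using symmetry_determined[OF s _ U v(1) vU] T by auto
    then show "s \<in> T" using t by simp
  qed
  have gen: "g \<otimes>\<^bsub>?G\<^esub> t = t \<otimes>\<^bsub>?G\<^esub> g" if g: "g \<in> ?X" and t: "t \<in> T" for g t
  proof -
    obtain M where M: "M \<in> line_perp S U" "g \<in> symmetries S M" using g by blast
    have "g (t x) = t (g x)" if x: "x \<in> P" for x
    proof (cases "M = U")
      case True
      then show ?thesis using abel sym_T M t x by blast
    next
      case False
      then obtain e where "e \<in> M" "e \<in> U" "M \<in> Lines S" using M by (auto simp: line_perp_def)
      then show ?thesis
        using concurrent_symmetries_commute[OF M(2) _ _ U False] t T x by blast
    qed
    then have "compose P g t = compose P t g" by (auto simp: compose_def)
    moreover have "g \<in> automorphisms S" "t \<in> automorphisms S"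
      using M t T symmetriesD(1) by blast+
    ultimately show ?thesis by (simp add: Aut_group_simps)
  qed
  \<comment> \<open>Elements commuting with all of \<open>T\<close> are closed under products and
    inverses, so it is enough that the generators commute with \<open>T\<close>.\<close>
  have cent: "g \<in> carrier ?G \<and> (\<forall>t\<in>T. g \<otimes>\<^bsub>?G\<^esub> t = t \<otimes>\<^bsub>?G\<^esub> g)" if "g \<in> generate ?G ?X" for g
    using that
  proof (induction rule: generate.induct)
    case one
    then show ?case using Tc by auto
  next
    case (incl h)
    then show ?case using gen X by blast
  next
    case (inv h)
    then have h: "h \<in> carrier ?G" using X by blast
    have "inv\<^bsub>?G\<^esub> h \<otimes>\<^bsub>?G\<^esub> t = t \<otimes>\<^bsub>?G\<^esub> inv\<^bsub>?G\<^esub> h" if t: "t \<in> T" for t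
    proof -
      have tc: "t \<in> carrier ?G" using Tc t by blast
      have "inv\<^bsub>?G\<^esub> h \<otimes>\<^bsub>?G\<^esub> t \<otimes>\<^bsub>?G\<^esub> h = inv\<^bsub>?G\<^esub> h \<otimes>\<^bsub>?G\<^esub> (h \<otimes>\<^bsub>?G\<^esub> t)"
        using gen[OF inv t] h tc by (simp add: G.m_assoc)
      also have "\<dots> = t"
        using h tc by (simp flip: G.m_assoc)
      finally have "t = inv\<^bsub>?G\<^esub> h \<otimes>\<^bsub>?G\<^esub> t \<otimes>\<^bsub>?G\<^esub> h" ..
      then show ?thesis
        using G.inv_solve_right'[of "inv\<^bsub>?G\<^esub> h \<otimes>\<^bsub>?G\<^esub> t" t h] h tc by simp
    qed
    then show ?case using h by blast
  next
    case (eng h1 h2)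
    have "h1 \<otimes>\<^bsub>?G\<^esub> h2 \<otimes>\<^bsub>?G\<^esub> t = t \<otimes>\<^bsub>?G\<^esub> (h1 \<otimes>\<^bsub>?G\<^esub> h2)" if t: "t \<in> T" for t
    proof -
      have tc: "t \<in> carrier ?G" using Tc t by blast
      have "h1 \<otimes>\<^bsub>?G\<^esub> h2 \<otimes>\<^bsub>?G\<^esub> t = h1 \<otimes>\<^bsub>?G\<^esub> (t \<otimes>\<^bsub>?G\<^esub> h2)"
        using eng t tc by (simp add: G.m_assoc)
      also have "\<dots> = h1 \<otimes>\<^bsub>?G\<^esub> t \<otimes>\<^bsub>?G\<^esub> h2"
        using eng tc by (simp add: G.m_assoc)
      also have "\<dots> = t \<otimes>\<^bsub>?G\<^esub> (h1 \<otimes>\<^bsub>?G\<^esub> h2)"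
        using eng t tc by (simp add: G.m_assoc)
      finally show ?thesis .
    qed
    then show ?case using eng by simp
  qed
  have "f = \<one>\<^bsub>?G\<^esub>" if f: "f \<in> TGQ_kernel S u v" "f \<in> symmetry_group S U" for f
  proof (rule kernel_commuting_with_transitive_symmetries[OF U u v T trans f(1)])
    fix t x assume t: "t \<in> T" and x: "x \<in> P"
    have "t \<in> automorphisms S" using t Tc by (auto simp: Aut_group_simps(1))
    moreover have "f \<in> automorphisms S" using f(1) by (simp add: TGQ_kernel_def)
    moreover have "f \<otimes>\<^bsub>?G\<^esub> t = t \<otimes>\<^bsub>?G\<^esub> f"
      using cent f(2) t unfolding symmetry_group_def by blast
    ultimately have "compose P f t = compose P t f" by (simp add: Aut_group_simps)
    then have "compose P f t x = compose P t f x" by simp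
    then show "f (t x) = t (f x)" using x by (simp add: compose_def)
  qed
  moreover have "\<one>\<^bsub>?G\<^esub> \<in> TGQ_kernel S u v"
    using G.one_closed line_subset
    by (auto simp: TGQ_kernel_def Aut_group_simps subset_iff)
  moreover have "\<one>\<^bsub>?G\<^esub> \<in> symmetry_group S U"
    unfolding symmetry_group_def by (rule generate.one)
  ultimately show ?thesis by blast
qed

end
section \<open>The quadric\<close>

definition polar_form :: "'a::field ^ 5 \<Rightarrow> 'a ^ 5 \<Rightarrow> 'a" where
  "polar_form x y = 2 * x $ 0 * y $ 0 + x $ 1 * y $ 2 + x $ 2 * y $ 1 + x $ 3 * y $ 4 + x $ 4 * y $ 3"

lemma exhaust_5: "(i::5) = 0 \<or> i = 1 \<or> i = 2 \<or> i = 3 \<or> i = 4"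
proof (induct i)
  case (of_int z)
  then have "z = 0 \<or> z = 1 \<or> z = 2 \<or> z = 3 \<or> z = 4" by fastforce
  then show ?case by auto
qed

lemma forall_5: "(\<forall>i::5. P i) \<longleftrightarrow> P 0 \<and> P 1 \<and> P 2 \<and> P 3 \<and> P 4"
  by (metis exhaust_5)

lemma polar_form_add_left: "polar_form (x + y) z = polar_form x z + polar_form y z"
  and polar_form_add_right: "polar_form z (x + y) = polar_form z x + polar_form z y"
  and polar_form_scale_left: "polar_form (k *s x) z = k * polar_form x z"
  and polar_form_scale_right: "polar_form z (k *s x) = k * polar_form z x"
  and polar_form_diff_right: "polar_form z (x - y) = polar_form z x - polar_form z y"
  and polar_form_diff_left: "polar_form (x - y) z = polar_form x z - polar_form y z"
  and polar_form_commute: "polar_form x y = polar_form y x"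
  by (simp_all add: polar_form_def algebra_simps)

lemma parabolic_form_add: "parabolic_form (x + y) = parabolic_form x + parabolic_form y + polar_form x y"
  and parabolic_form_diff: "parabolic_form (x - y) = parabolic_form x + parabolic_form y - polar_form x y"
  and parabolic_form_scale: "parabolic_form (k *s x) = k\<^sup>2 * parabolic_form x"
  and polar_form_self: "polar_form x x = 2 * parabolic_form x"
  by (simp_all add: polar_form_def parabolic_form_def algebra_simps power2_eq_square)

lemmas polar_simps = polar_form_add_left polar_form_add_right polar_form_scale_left
  polar_form_scale_right polar_form_diff_right

section \<open>Subspaces spanned by one or two vectors\<close>

lemma mem_span_2: "r \<in> vec.span {x, y} \<longleftrightarrow> (\<exists>\<alpha> \<beta>. r = \<alpha> *s x + \<beta> *s y)"
  by (auto simp: vec.span_breakdown_eq[of _ x] vec.span_singleton image_iff diff_eq_eq add.commute)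

lemma mem_span_1: "r \<in> vec.span {x} \<longleftrightarrow> (\<exists>\<alpha>. r = \<alpha> *s x)"
  by (auto simp: vec.span_singleton)

lemma independent_pair: "x \<noteq> 0 \<Longrightarrow> y \<notin> vec.span {x} \<Longrightarrow> vec.independent {x, y}"
  and neq_pair: "y \<notin> vec.span {x} \<Longrightarrow> x \<noteq> y"
proof -
  show "y \<notin> vec.span {x} \<Longrightarrow> x \<noteq> y" using vec.span_base[of x "{x}"] by auto
  assume "x \<noteq> 0" "y \<notin> vec.span {x}"
  then have "vec.independent {y, x}" by (simp add: vec.independent_insert)
  then show "vec.independent {x, y}" by (simp add: insert_commute)
qed

lemma span_swap:
  assumes "x \<noteq> 0" "y \<notin> vec.span {x}" shows "y \<noteq> 0" "x \<notin> vec.span {y}"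
proof -
  show "y \<noteq> 0" using assms(2) vec.span_zero by auto
  show "x \<notin> vec.span {y}"
  proof
    assume "x \<in> vec.span {y}"
    then obtain k where k: "x = k *s y" by (auto simp: mem_span_1)
    then have "k \<noteq> 0" using assms by auto
    then have "inverse k *s x = y" unfolding k by (simp add: vec.scale_scale)
    then show False using assms(2) unfolding mem_span_1 by metis
  qed
qed

lemma dim_span_pair: "x \<noteq> 0 \<Longrightarrow> y \<notin> vec.span {x} \<Longrightarrow> vec.dim (vec.span {x, y}) = 2"
  using independent_pair[of x y] neq_pair[of y x]
  by (simp add: vec.dim_span_eq_card_independent del: vec.dim_span)

lemma span_pair_eq:
  assumes W: "vec.subspace W" "vec.dim W = 2" and x: "x \<in> W" "x \<noteq> 0" and y: "y \<in> W" "y \<notin> vec.span {x}"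
  shows "W = vec.span {x, y}"
proof (rule vec.subspace_dim_equal[symmetric])
  show "vec.span {x, y} \<subseteq> W" using x(1) y(1) W(1) by (intro vec.span_minimal) auto
  show "vec.dim W \<le> vec.dim (vec.span {x, y})"
    using dim_span_pair[OF x(2) y(2)] W(2) by (simp del: vec.dim_span)
qed (use W(1) in auto)

lemma dim_2_obtain_second:
  assumes W: "vec.subspace W" "vec.dim W = 2"
  obtains y where "y \<in> W" "y \<notin> vec.span {x}"
proof -
  have "\<not> W \<subseteq> vec.span {x}"
  proof
    assume "W \<subseteq> vec.span {x}"
    then have "vec.dim W \<le> card {x}" by (intro vec.dim_le_card) auto
    then show False using W by simp
  qed
  then show ?thesis using that by blast
qed

lemma dim_2_obtain_first:
  assumes W: "vec.dim W = 2"
  obtains x where "x \<in> W" "x \<noteq> 0"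
proof -
  have "\<not> W \<subseteq> {0}" using W vec.dim_eq_0[of W] by auto
  then show ?thesis using that by blast
qed

section \<open>Totally singular subspaces, and the points and lines they give\<close>

lemma totally_singular_polar:
  assumes "totally_singular W" "x \<in> W" "y \<in> W"
  shows "polar_form x y = 0"
proof -
  have "x + y \<in> W" using assms vec.subspace_add by (auto simp: totally_singular_def)
  then show ?thesis using assms parabolic_form_add[of x y] by (auto simp: totally_singular_def)
qed

lemma totally_singular_span_pair:
  assumes "parabolic_form x = 0" "parabolic_form y = 0" "polar_form x y = 0"
  shows "totally_singular (vec.span {x, y})"
  using assms
  by (auto simp: totally_singular_def mem_span_2 parabolic_form_add parabolic_form_scale polar_simps)

lemma Q4_points_iff: "X \<in> Q4_points \<longleftrightarrow> (\<exists>x. x \<noteq> 0 \<and> parabolic_form x = 0 \<and> X = vec.span {x})"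
proof
  assume X: "X \<in> Q4_points"
  obtain B where B: "B \<subseteq> X" "vec.independent B" "X \<subseteq> vec.span B" "card B = vec.dim X"
    using vec.basis_exists .
  have "card B = 1" using B(4) X by (simp add: Q4_points_def)
  then obtain x where x: "B = {x}" using card_1_singletonE by blast
  have "vec.span {x} \<subseteq> X"
    using vec.span_minimal[of B X] B(1) x X by (simp add: Q4_points_def totally_singular_def)
  then have "X = vec.span {x}" using B x by blast
  moreover have "x \<noteq> 0" using B(2) x vec.dependent_zero by blast
  moreover have "parabolic_form x = 0" using B(1) x X by (auto simp: Q4_points_def totally_singular_def)
  ultimately show "\<exists>x. x \<noteq> 0 \<and> parabolic_form x = 0 \<and> X = vec.span {x}" by blast
next
  assume "\<exists>x. x \<noteq> 0 \<and> parabolic_form x = 0 \<and> X = vec.span {x}"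
  then obtain x where x: "x \<noteq> 0" "parabolic_form x = 0" "X = vec.span {x}" by blast
  have "vec.dim X = 1"
    using x vec.dim_span_eq_card_independent[of "{x}"] by simp
  then show "X \<in> Q4_points"
    using x by (auto simp: Q4_points_def totally_singular_def mem_span_1 parabolic_form_scale)
qed

lemma span_in_Q4_points: "x \<noteq> 0 \<Longrightarrow> parabolic_form x = 0 \<Longrightarrow> vec.span {x} \<in> Q4_points"
  by (auto simp: Q4_points_iff)

definition points_on :: "('a::field ^ 5) set \<Rightarrow> ('a ^ 5) set set" where
  "points_on W = {X \<in> Q4_points. X \<subseteq> W}"

lemma Points_Q4: "Points Q4 = Q4_points"
  by (simp add: Q4_def)

lemma Lines_Q4: "l \<in> Lines Q4 \<longleftrightarrow> (\<exists>W. totally_singular W \<and> vec.dim W = 2 \<and> l = points_on W)"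
  by (auto simp: Q4_def points_on_def)

lemma Lines_Q4_span:
  assumes "x \<noteq> 0" "y \<notin> vec.span {x}" "parabolic_form x = 0" "parabolic_form y = 0" "polar_form x y = 0"
  shows "points_on (vec.span {x, y}) \<in> Lines Q4"
  using assms totally_singular_span_pair dim_span_pair unfolding Lines_Q4 by blast

lemma span_subset_iff: "vec.subspace W \<Longrightarrow> vec.span {x} \<subseteq> W \<longleftrightarrow> x \<in> W"
  using vec.span_minimal[of "{x}" W] vec.span_base[of x "{x}"] by auto

lemma span_mem_points_on:
  assumes "totally_singular W" "x \<noteq> 0"
  shows "vec.span {x} \<in> points_on W \<longleftrightarrow> x \<in> W"
  using assms span_subset_iff[of W x] span_in_Q4_points[of x]
  by (auto simp: points_on_def totally_singular_def)

lemma points_onE: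
  assumes "totally_singular W" "X \<in> points_on W"
  obtains x where "x \<noteq> 0" "x \<in> W" "parabolic_form x = 0" "X = vec.span {x}"
proof -
  obtain x where x: "x \<noteq> 0" "parabolic_form x = 0" "X = vec.span {x}"
    using assms(2) by (auto simp: points_on_def Q4_points_iff)
  then have "x \<in> W" using assms span_mem_points_on by blast
  then show ?thesis using that x by blast
qed

lemma span_single_neq: "x \<noteq> 0 \<Longrightarrow> vec.span {x} \<noteq> vec.span {y} \<longleftrightarrow> y \<noteq> 0 \<longrightarrow> y \<notin> vec.span {x}"
proof (intro iffI impI notI)
  assume *: "x \<noteq> 0" "vec.span {x} \<noteq> vec.span {y}" "y \<noteq> 0" "y \<in> vec.span {x}"
  then have "x \<in> vec.span {y}" using span_swap[of y x] by blast
  then show False using * span_subset_iff[OF vec.subspace_span] by blast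
next
  assume *: "x \<noteq> 0" "y \<noteq> 0 \<longrightarrow> y \<notin> vec.span {x}" "vec.span {x} = vec.span {y}"
  show False
  proof (cases "y = 0")
    case True
    then show False using * vec.span_base[of x "{x}"] by auto
  next
    case False
    then show False using * vec.span_base[of y "{y}"] by auto
  qed
qed

text \<open>This is the bound 2 on the Witt index. A 3-dimensional space has a nonzero vector
  vanishing at any two prescribed coordinates; four such vectors, adapted to the hyperbolic pairs
  \<open>{1, 2}\<close> and \<open>{3, 4}\<close>, cannot be pairwise orthogonal.\<close>

lemma no_three_totally_singular:
  assumes ind: "\<And>\<alpha> \<beta> \<gamma>. \<alpha> *s x + \<beta> *s y + \<gamma> *s z = 0 \<Longrightarrow> \<alpha> = 0 \<and> \<beta> = 0 \<and> \<gamma> = 0"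
    and Q: "parabolic_form x = 0" "parabolic_form y = 0" "parabolic_form z = 0"
    and P: "polar_form x y = 0" "polar_form x z = 0" "polar_form y z = 0"
  shows False
proof -
  define X where "X = {w. \<exists>\<alpha> \<beta> \<gamma>. w = \<alpha> *s x + \<beta> *s y + \<gamma> *s z}"
  have ex: "\<exists>w\<in>X. w \<noteq> 0 \<and> w $ i = 0 \<and> w $ j = 0" for i j
  proof -
    have "\<exists>\<alpha> \<beta> \<gamma>. (\<alpha> \<noteq> 0 \<or> \<beta> \<noteq> 0 \<or> \<gamma> \<noteq> 0) \<and>
      \<alpha> * x $ i + \<beta> * y $ i + \<gamma> * z $ i = 0 \<and> \<alpha> * x $ j + \<beta> * y $ j + \<gamma> * z $ j = 0"
      (is "\<exists>\<alpha> \<beta> \<gamma>. ?sol \<alpha> \<beta> \<gamma>")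
    proof (cases "y $ i * z $ j = z $ i * y $ j \<and> z $ i * x $ j = x $ i * z $ j \<and> x $ i * y $ j = y $ i * x $ j")
      case False
      \<comment> \<open>The cross product of the two coefficient rows solves both equations. If it
        vanishes, the rows are proportional and a solution is read off from a nonzero row.\<close>
      then have "?sol (y $ i * z $ j - z $ i * y $ j) (z $ i * x $ j - x $ i * z $ j)
        (x $ i * y $ j - y $ i * x $ j)"
        by (auto simp: algebra_simps)
      then show ?thesis by blast
    next
      case True
      have s1: "?sol (y $ i) (- x $ i) 0" if "x $ i \<noteq> 0 \<or> y $ i \<noteq> 0"
        using True that by (auto simp: algebra_simps)
      have s2: "?sol (y $ j) (- x $ j) 0" if "x $ j \<noteq> 0 \<or> y $ j \<noteq> 0"
        using True that by (auto simp: algebra_simps)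
      have s3: "?sol 1 0 0" if "x $ i = 0" "x $ j = 0"
        using that by auto
      show ?thesis using s1 s2 s3 by blast
    qed
    then obtain \<alpha> \<beta> \<gamma> where s: "?sol \<alpha> \<beta> \<gamma>" by blast
    then have "\<alpha> *s x + \<beta> *s y + \<gamma> *s z \<noteq> 0" using ind by blast
    then show ?thesis using s unfolding X_def by (intro bexI[of _ "\<alpha> *s x + \<beta> *s y + \<gamma> *s z"]) auto
  qed
  have polar: "polar_form v w = 0" if "v \<in> X" "w \<in> X" for v w
    using that Q P polar_form_commute[of y x] polar_form_commute[of z x] polar_form_commute[of z y]
    by (auto simp: X_def polar_simps polar_form_self)
  have sing: "parabolic_form w = 0" if "w \<in> X" for w
    using that Q P by (auto simp: X_def polar_simps parabolic_form_add parabolic_form_scale)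
  \<comment> \<open>Each choice kills one coordinate from each hyperbolic pair, which reduces the
    form to the square of coordinate 0; hence that coordinate vanishes as well.\<close>
  obtain a where a: "a \<in> X" "a \<noteq> 0" "a $ 2 = 0" "a $ 4 = 0" using ex by blast
  obtain b where b: "b \<in> X" "b \<noteq> 0" "b $ 1 = 0" "b $ 3 = 0" using ex by blast
  obtain c where c: "c \<in> X" "c \<noteq> 0" "c $ 1 = 0" "c $ 4 = 0" using ex by blast
  obtain d where d: "d \<in> X" "d \<noteq> 0" "d $ 2 = 0" "d $ 3 = 0" using ex by blast
  have zero: "a $ 0 = 0" "b $ 0 = 0" "c $ 0 = 0" "d $ 0 = 0"
    using sing[OF a(1)] sing[OF b(1)] sing[OF c(1)] sing[OF d(1)] a b c d
    by (simp_all add: parabolic_form_def)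
  have nz: "a $ 1 \<noteq> 0 \<or> a $ 3 \<noteq> 0" "b $ 2 \<noteq> 0 \<or> b $ 4 \<noteq> 0" "c $ 2 \<noteq> 0 \<or> c $ 3 \<noteq> 0" "d $ 1 \<noteq> 0 \<or> d $ 4 \<noteq> 0"
    using a b c d zero by (auto simp: vec_eq_iff forall_5)
  have "a $ 1 * b $ 2 + a $ 3 * b $ 4 = 0" "a $ 1 * c $ 2 = 0" "a $ 3 * d $ 4 = 0"
    "b $ 4 * c $ 3 = 0" "b $ 2 * d $ 1 = 0"
    using polar[OF a(1) b(1)] polar[OF a(1) c(1)] polar[OF a(1) d(1)] polar[OF b(1) c(1)]
      polar[OF b(1) d(1)] a b c d zero
    by (simp_all add: polar_form_def)
  then show False using nz by auto
qed

text \<open>\<open>x\<close>, \<open>y\<close>, \<open>z\<close> would span a totally singular space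
  of dimension 3. This gives uniqueness of projections, and later shows that a Siegel transformation
  with nonzero parameter moves points off its axis.\<close>

lemma no_totally_singular_beyond_line:
  assumes W: "totally_singular W" "vec.dim W = 2" and x: "x \<notin> W" "parabolic_form x = 0"
    and y: "y \<in> W" "y \<noteq> 0" "polar_form x y = 0" and z: "z \<in> W" "z \<notin> vec.span {y}" "polar_form x z = 0"
  shows False
proof (rule no_three_totally_singular[of x y z])
  fix \<alpha> \<beta> \<gamma> assume eq: "\<alpha> *s x + \<beta> *s y + \<gamma> *s z = 0"
  have sub: "vec.subspace W" using W by (simp add: totally_singular_def)
  have \<alpha>: "\<alpha> = 0"
  proof (rule ccontr)
    assume "\<alpha> \<noteq> 0"
    then have "x = inverse \<alpha> *s (\<alpha> *s x)" by simp
    also have "\<alpha> *s x = - (\<beta> *s y + \<gamma> *s z)" using eq by (metis add.assoc eq_neg_iff_add_eq_0)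
    finally have "x = inverse \<alpha> *s (- (\<beta> *s y + \<gamma> *s z))" .
    moreover have "inverse \<alpha> *s (- (\<beta> *s y + \<gamma> *s z)) \<in> W"
      using sub y z by (intro vec.subspace_scale vec.subspace_neg vec.subspace_add)
    ultimately show False using x by simp
  qed
  have \<gamma>: "\<gamma> = 0"
  proof (rule ccontr)
    assume "\<gamma> \<noteq> 0"
    then have "z = inverse \<gamma> *s (\<gamma> *s z)" by simp
    also have "\<gamma> *s z = (- \<beta>) *s y" using eq \<alpha> by (simp add: eq_neg_iff_add_eq_0 add.commute)
    finally have "z = (inverse \<gamma> * (- \<beta>)) *s y" by (simp add: vec.scale_scale)
    then show False using z(2) unfolding mem_span_1 by blast
  qed
  show "\<alpha> = 0 \<and> \<beta> = 0 \<and> \<gamma> = 0" using eq \<alpha> \<gamma> y by simp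
qed (use W x y z totally_singular_polar in \<open>auto simp: totally_singular_def\<close>)

lemma collinear_Q4_imp:
  assumes "collinear_in Q4 (vec.span {x}) (vec.span {y})"
  shows "polar_form x y = 0"
proof -
  obtain W where W: "totally_singular W" "vec.span {x} \<subseteq> W" "vec.span {y} \<subseteq> W"
    using assms by (auto simp: collinear_in_def Lines_Q4 points_on_def)
  then show ?thesis using totally_singular_polar vec.span_base by blast
qed

lemma collinear_Q4I:
  assumes "x \<noteq> 0" "y \<notin> vec.span {x}" "parabolic_form x = 0" "parabolic_form y = 0" "polar_form x y = 0"
  shows "collinear_in Q4 (vec.span {x}) (vec.span {y})"
proof -
  have "y \<noteq> 0" using span_swap assms by blast
  then have "vec.span {x} \<in> points_on (vec.span {x, y})" "vec.span {y} \<in> points_on (vec.span {x, y})"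
    using span_mem_points_on[OF totally_singular_span_pair] assms vec.span_base by blast+
  then show ?thesis using Lines_Q4_span[OF assms] by (auto simp: collinear_in_def)
qed

text \<open>The quotient of the tangent hyperplane at \<open>x\<close> by \<open>x\<close> carries the ternary form
  \<open>r\<^sup>2 + s t\<close>; \<open>D\<close> parametrizes a complement of \<open>x\<close> in that hyperplane.\<close>

lemma perp_parametrization:
  fixes x :: "'a::field ^ 5"
  assumes "x \<noteq> 0" "parabolic_form x = 0"
  obtains D i where "x $ i \<noteq> 0" "\<And>r s t. D r s t $ i = 0" "\<And>r s t. polar_form x (D r s t) = 0"
    "\<And>r s t. parabolic_form (D r s t) = r\<^sup>2 + s * t"
    "\<And>k r s t r' s' t'. D r s t = k *s D r' s' t' \<Longrightarrow> r = k * r' \<and> s = k * s' \<and> t = k * t'"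
proof -
  define V :: "'a \<Rightarrow> 'a \<Rightarrow> 'a \<Rightarrow> 'a \<Rightarrow> 'a \<Rightarrow> 'a ^ 5" where
    "V a b c d e = (\<chi> i. if i = 0 then a else if i = 1 then b else if i = 2 then c else if i = 3 then d else e)"
    for a b c d e
  have [simp]: "V a b c d e $ 0 = a" "V a b c d e $ 1 = b" "V a b c d e $ 2 = c" "V a b c d e $ 3 = d"
    "V a b c d e $ 4 = e" for a b c d e
    by (simp_all add: V_def)
  have "\<not> (x $ 1 = 0 \<and> x $ 2 = 0 \<and> x $ 3 = 0 \<and> x $ 4 = 0)"
    using assms by (auto simp: vec_eq_iff forall_5 parabolic_form_def)
  then consider "x $ 1 \<noteq> 0" | "x $ 2 \<noteq> 0" | "x $ 3 \<noteq> 0" | "x $ 4 \<noteq> 0" by blast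
  then show thesis
  proof cases
    case 1
    then show ?thesis
      \<comment> \<open>Coordinate 1 is set to 0, which removes the product of coordinates 1 and 2
        from the form; coordinate 2 is the solution of orthogonality to \<open>x\<close>. The other
        cases use the partner coordinate in the same way.\<close>
      by (intro that[of 1 "\<lambda>r s t. V r 0 (- (2 * x $ 0 * r + x $ 3 * t + x $ 4 * s) / x $ 1) s t"])
        (auto simp: polar_form_def parabolic_form_def vec_eq_iff forall_5)
  next
    case 2
    then show ?thesis
      by (intro that[of 2 "\<lambda>r s t. V r (- (2 * x $ 0 * r + x $ 3 * t + x $ 4 * s) / x $ 2) 0 s t"])
        (auto simp: polar_form_def parabolic_form_def vec_eq_iff forall_5)
  next
    case 3
    then show ?thesis
      by (intro that[of 3 "\<lambda>r s t. V r s t 0 (- (2 * x $ 0 * r + x $ 1 * t + x $ 2 * s) / x $ 3)"])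
        (auto simp: polar_form_def parabolic_form_def vec_eq_iff forall_5)
  next
    case 4
    then show ?thesis
      by (intro that[of 4 "\<lambda>r s t. V r s t (- (2 * x $ 0 * r + x $ 1 * t + x $ 2 * s) / x $ 4) 0"])
        (auto simp: polar_form_def parabolic_form_def vec_eq_iff forall_5)
  qed
qed

text \<open>Lines through \<open>X\<close> correspond to the points of the conic
  \<open>r\<^sup>2 + s * t = 0\<close>. The triples (0,1,0), (0,0,1) and (1,1,-1) are three distinct
  points on it in every field.\<close>

lemma third_line_Q4:
  fixes X :: "('a::field ^ 5) set"
  assumes "X \<in> Q4_points"
  shows "\<exists>m\<in>Lines Q4. X \<in> m \<and> m \<noteq> k \<and> m \<noteq> l"
proof -
  obtain x where x: "x \<noteq> 0" "parabolic_form x = 0" "X = vec.span {x}"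
    using assms by (auto simp: Q4_points_iff)
  obtain D i where D: "x $ i \<noteq> 0" "\<And>r s t. D r s t $ i = 0" "\<And>r s t. polar_form x (D r s t) = 0"
    "\<And>r s t. parabolic_form (D r s t) = r\<^sup>2 + s * t"
    "\<And>k r s t r' s' t'. D r s t = k *s D r' s' t' \<Longrightarrow> r = k * r' \<and> s = k * s' \<and> t = k * t'"
    using perp_parametrization[OF x(1,2)] by metis
  have span_D: "\<exists>\<beta>. r = \<beta> * r' \<and> s = \<beta> * s' \<and> t = \<beta> * t'"
    if D_in: "D r s t \<in> vec.span {x, D r' s' t'}" for r s t r' s' t'
  proof -
    obtain \<alpha> \<beta> where ab: "D r s t = \<alpha> *s x + \<beta> *s D r' s' t'" using D_in by (auto simp: mem_span_2)
    \<comment> \<open>Coordinate \<open>i\<close> vanishes on all values of \<open>D\<close> but not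
      at \<open>x\<close>, so it isolates the coefficient of \<open>x\<close>.\<close>
    then have "D r s t $ i = \<alpha> * x $ i + \<beta> * D r' s' t' $ i" by simp
    then have "\<alpha> = 0" using D(1,2) by simp
    then show ?thesis using ab D(5)[of r s t \<beta>] by auto
  qed
  define L where "L r s t = points_on (vec.span {x, D r s t})" for r s t
  have L: "L r s t \<in> Lines Q4 \<and> X \<in> L r s t \<and> vec.span {D r s t} \<in> L r s t \<and> D r s t \<noteq> 0
      \<and> totally_singular (vec.span {x, D r s t})"
    if rst: "r\<^sup>2 + s * t = 0" "r \<noteq> 0 \<or> s \<noteq> 0 \<or> t \<noteq> 0" for r s t
  proof -
    have "D r s t \<notin> vec.span {x}"
    proof
      assume "D r s t \<in> vec.span {x}"
      then have "D r s t \<in> vec.span {x, D 0 0 0}" using vec.span_mono[of "{x}" "{x, D 0 0 0}"] by blast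
      then show False using span_D[of r s t 0 0 0] rst by auto
    qed
    then have nz: "D r s t \<noteq> 0" and line: "L r s t \<in> Lines Q4"
      using span_swap[OF x(1)] Lines_Q4_span[OF x(1)] x D rst by (auto simp: L_def)
    have ts: "totally_singular (vec.span {x, D r s t})"
      using x D rst by (intro totally_singular_span_pair) auto
    note line nz
    moreover have "X \<in> L r s t" "vec.span {D r s t} \<in> L r s t"
      using span_mem_points_on[OF ts] x nz vec.span_base[of _ "{x, D r s t}"] by (simp_all add: L_def)
    ultimately show ?thesis using ts by blast
  qed
  have neq: "L r s t \<noteq> L r' s' t'"
    if "r\<^sup>2 + s * t = 0" "r \<noteq> 0 \<or> s \<noteq> 0 \<or> t \<noteq> 0" "r'\<^sup>2 + s' * t' = 0" "r' \<noteq> 0 \<or> s' \<noteq> 0 \<or> t' \<noteq> 0"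
      "\<not> (\<exists>\<beta>. r = \<beta> * r' \<and> s = \<beta> * s' \<and> t = \<beta> * t')" for r s t r' s' t'
  proof
    assume "L r s t = L r' s' t'"
    then have "D r s t \<in> vec.span {x, D r' s' t'}"
      using L[OF that(1,2)] L[OF that(3,4)] span_mem_points_on by (metis L_def)
    then show False using span_D that(5) by blast
  qed
  have "L 0 1 0 \<noteq> L 0 0 1" "L 0 1 0 \<noteq> L 1 1 (-1)" "L 0 0 1 \<noteq> L 1 1 (-1)"
    by (rule neq; auto)+
  moreover have "L 0 1 0 \<in> Lines Q4 \<and> X \<in> L 0 1 0" "L 0 0 1 \<in> Lines Q4 \<and> X \<in> L 0 0 1"
    "L 1 1 (-1) \<in> Lines Q4 \<and> X \<in> L 1 1 (-1)"
    using L[of 0 1 0] L[of 0 0 1] L[of 1 1 "-1"] by auto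
  ultimately show ?thesis by metis
qed

interpretation Q4: gen_quad "Q4 :: ('a::field ^ 5) set geometry"
proof
  fix l m k :: "('a ^ 5) set set" and X Y Z
  show "l \<subseteq> Points Q4" if "l \<in> Lines Q4"
    using that by (auto simp: Lines_Q4 Points_Q4 points_on_def)
  show "\<exists>m\<in>Lines Q4. X \<in> m \<and> m \<noteq> k \<and> m \<noteq> l" if "X \<in> Points Q4"
    using third_line_Q4 that by (simp add: Points_Q4)
  show "l = m"
    if l: "l \<in> Lines Q4" "m \<in> Lines Q4" "X \<in> l" "Y \<in> l" "X \<in> m" "Y \<in> m" "X \<noteq> Y"
  proof -
    obtain W where W: "totally_singular W" "vec.dim W = 2" "l = points_on W" using l by (auto simp: Lines_Q4)
    obtain W' where W': "totally_singular W'" "vec.dim W' = 2" "m = points_on W'" using l by (auto simp: Lines_Q4)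
    obtain x where x: "x \<noteq> 0" "x \<in> W" "X = vec.span {x}" using points_onE W l by metis
    obtain y where y: "y \<noteq> 0" "y \<in> W" "Y = vec.span {y}" using points_onE W l by metis
    have "x \<in> W'" "y \<in> W'" using span_mem_points_on[OF W'(1)] x y l W' by auto
    moreover have "y \<notin> vec.span {x}" using span_single_neq[of x y] x y l by auto
    ultimately have "W = vec.span {x, y}" "W' = vec.span {x, y}"
      using span_pair_eq[of W x y] span_pair_eq[of W' x y] W W' x y
      unfolding totally_singular_def by blast+
    then show ?thesis using W W' by simp
  qed
  show "\<exists>Y\<in>l. collinear_in Q4 X Y" if X: "X \<in> Points Q4" "l \<in> Lines Q4" "X \<notin> l"
  proof -
    obtain W where W: "totally_singular W" "vec.dim W = 2" "l = points_on W" using X by (auto simp: Lines_Q4)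
    have sub: "vec.subspace W" using W by (simp add: totally_singular_def)
    obtain x where x: "x \<noteq> 0" "parabolic_form x = 0" "X = vec.span {x}"
      using X by (auto simp: Points_Q4 Q4_points_iff)
    have xW: "x \<notin> W" using span_mem_points_on[OF W(1) x(1)] X x W by simp
    obtain b where b: "b \<in> W" "b \<noteq> 0" using dim_2_obtain_first[OF W(2)] .
    obtain c where c: "c \<in> W" "c \<notin> vec.span {b}" using dim_2_obtain_second[OF sub W(2)] .
    obtain w where w: "w \<in> W" "w \<noteq> 0" "polar_form x w = 0"
    proof (cases "polar_form x c = 0")
      case True
      then show ?thesis using that c span_swap[OF b(2)] by blast
    next
      case False
      \<comment> \<open>The combination of \<open>b\<close> and \<open>c\<close> on which the
        functional \<open>polar_form x\<close> vanishes.\<close>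
      let ?w = "polar_form x c *s b - polar_form x b *s c"
      have "?w \<in> W" using sub b c by (intro vec.subspace_diff vec.subspace_scale)
      moreover have "?w \<noteq> 0"
      proof
        assume "?w = 0"
        then have "inverse (polar_form x c) *s (polar_form x c *s b) = inverse (polar_form x c) *s (polar_form x b *s c)"
          by simp
        then have "b = (inverse (polar_form x c) * polar_form x b) *s c" using False by (simp add: vec.scale_scale)
        then show False using span_swap(2)[OF b(2) c(2)] by (auto simp: mem_span_1)
      qed
      moreover have "polar_form x ?w = 0" by (simp add: polar_simps)
      ultimately show ?thesis using that by blast
    qed
    have "x \<notin> vec.span {w}" using span_subset_iff[OF sub, of w] w xW by blast
    then have "w \<notin> vec.span {x}" using span_swap[OF w(2)] span_swap[OF x(1)] x w 
      by (metis mem_span_1 span_single_neq vec.span_base insertI1)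
    then have "collinear_in Q4 X (vec.span {w})"
      using collinear_Q4I[OF x(1)] x w W by (auto simp: totally_singular_def)
    then show ?thesis using span_mem_points_on[OF W(1)] w W by blast
  qed
  show "Y = Z"
    if l: "l \<in> Lines Q4" "X \<notin> l" "Y \<in> l" "Z \<in> l" "collinear_in Q4 X Y" "collinear_in Q4 X Z"
  proof (rule ccontr)
    assume "Y \<noteq> Z"
    obtain W where W: "totally_singular W" "vec.dim W = 2" "l = points_on W" using l by (auto simp: Lines_Q4)
    obtain m where "m \<in> Lines Q4" "X \<in> m" using l(5) by (auto simp: collinear_in_def)
    then have "X \<in> Q4_points" by (auto simp: Lines_Q4 points_on_def)
    then obtain x where x: "x \<noteq> 0" "parabolic_form x = 0" "X = vec.span {x}"
      by (auto simp: Q4_points_iff)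
    obtain y where y: "y \<noteq> 0" "y \<in> W" "Y = vec.span {y}" using points_onE W l by metis
    obtain z where z: "z \<noteq> 0" "z \<in> W" "Z = vec.span {z}" using points_onE W l by metis
    have "z \<notin> vec.span {y}" using span_single_neq[of y z] y z \<open>Y \<noteq> Z\<close> by auto
    moreover have "x \<notin> W" using span_mem_points_on[OF W(1) x(1)] l x W by simp
    moreover have "polar_form x y = 0" "polar_form x z = 0"
      using collinear_Q4_imp l x y z by auto
    ultimately show False using no_totally_singular_beyond_line[OF W(1,2)] x y z by blast
  qed
  show "\<exists>Z\<in>l. Z \<noteq> X \<and> Z \<noteq> Y" if l: "l \<in> Lines Q4"
  proof -
    obtain W where W: "totally_singular W" "vec.dim W = 2" "l = points_on W" using l by (auto simp: Lines_Q4)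
    have sub: "vec.subspace W" using W by (simp add: totally_singular_def)
    obtain b where b: "b \<in> W" "b \<noteq> 0" using dim_2_obtain_first[OF W(2)] .
    obtain c where c: "c \<in> W" "c \<notin> vec.span {b}" using dim_2_obtain_second[OF sub W(2)] .
    have c0: "c \<noteq> 0" "b \<notin> vec.span {c}" using span_swap[OF b(2) c(2)] by auto
    \<comment> \<open>\<open>b\<close>, \<open>c\<close> and \<open>b + c\<close> span three
      different points over any field, so one of them avoids both \<open>X\<close> and
      \<open>Y\<close>.\<close>
    have bc: "b + c \<in> W" using vec.subspace_add[OF sub] b c by blast
    have bcb: "b + c \<notin> vec.span {b}" "b + c \<notin> vec.span {c}"
      using c0 c vec.span_add_eq[of b "{b}" c] vec.span_add_eq2[of c "{c}" b] vec.span_base by auto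
    have bc0: "b + c \<noteq> 0" using bcb(1) vec.span_zero[of "{b}"] by metis
    have "vec.span {b} \<noteq> vec.span {c}" "vec.span {b} \<noteq> vec.span {b + c}" "vec.span {c} \<noteq> vec.span {b + c}"
      using span_single_neq[of b c] span_single_neq[of b "b + c"] span_single_neq[of c "b + c"]
        b c c0 bcb by simp_all
    moreover have "vec.span {b} \<in> l" "vec.span {c} \<in> l" "vec.span {b + c} \<in> l"
      using span_mem_points_on[OF W(1)] W(3) b c c0 bc bc0 by auto
    ultimately show ?thesis by metis
  qed
qed

section \<open>Siegel transformations\<close>

text \<open>The inverse isometry \<open>g\<close> is given explicitly, so surjectivity on points and
  lines is the forward statement applied to \<open>g\<close>. For this reason the local facts are
  proved for a general pair \<open>h\<close>, \<open>k\<close>.\<close>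

lemma isometry_automorphism:
  fixes f g :: "'a::field ^ 5 \<Rightarrow> 'a ^ 5"
  assumes f: "\<And>x y. f (x + y) = f x + f y" "\<And>k x. f (k *s x) = k *s f x"
      "\<And>x. parabolic_form (f x) = parabolic_form x"
    and g: "\<And>x y. g (x + y) = g x + g y" "\<And>k x. g (k *s x) = k *s g x"
      "\<And>x. parabolic_form (g x) = parabolic_form x"
    and gf: "\<And>x. g (f x) = x" and fg: "\<And>x. f (g x) = x"
  shows "(\<lambda>X\<in>Points Q4. f ` X) \<in> automorphisms Q4"
    and "totally_singular W \<Longrightarrow> vec.dim W = 2 \<Longrightarrow>
      (\<lambda>X\<in>Points Q4. f ` X) ` points_on W = points_on (f ` W)"
proof -
  have pt: "h ` X \<in> Q4_points"
    if h: "\<And>x y. h (x + y) = h x + h y" "\<And>k x. h (k *s x) = k *s h x"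
      "\<And>x. parabolic_form (h x) = parabolic_form x" "\<And>x. k (h x) = x" and X: "X \<in> Q4_points"
    for h k :: "'a ^ 5 \<Rightarrow> 'a ^ 5" and X
  proof -
    obtain x where x: "x \<noteq> 0" "parabolic_form x = 0" "X = vec.span {x}"
      using X by (auto simp: Q4_points_iff)
    have "h 0 = 0" using h(2)[of 0 0] by simp
    then have "h x \<noteq> 0" using x(1) h(4) by metis
    moreover have "h ` X = vec.span {h x}"
      unfolding x(3) vec.span_singleton image_image h(2) by (rule refl)
    ultimately show ?thesis using x h(3) by (auto simp: Q4_points_iff)
  qed
  have ptf: "f ` X \<in> Q4_points" if "X \<in> Q4_points" for X using pt[OF f gf that] .
  have ptg: "g ` X \<in> Q4_points" if "X \<in> Q4_points" for X using pt[OF g fg that] .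
  have gfi: "g ` f ` X = X" "f ` g ` X = X" for X by (simp_all add: image_image gf fg)
  have img: "(\<lambda>X\<in>Points Q4. h ` X) ` points_on W = points_on (h ` W)"
    if pth: "\<And>X. X \<in> Q4_points \<Longrightarrow> h ` X \<in> Q4_points" and ptk: "\<And>X. X \<in> Q4_points \<Longrightarrow> k ` X \<in> Q4_points"
      and kh: "\<And>X. k ` h ` X = X" and hk: "\<And>X. h ` k ` X = X"
    for h k :: "'a ^ 5 \<Rightarrow> 'a ^ 5" and W
  proof (intro equalityI subsetI)
    fix Y assume "Y \<in> (\<lambda>X\<in>Points Q4. h ` X) ` points_on W"
    then show "Y \<in> points_on (h ` W)" using pth by (auto simp: points_on_def Points_Q4)
  next
    fix Y assume Y: "Y \<in> points_on (h ` W)"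
    then have "k ` Y \<subseteq> k ` h ` W" unfolding points_on_def by blast
    then have "k ` Y \<in> points_on W" using Y ptk kh by (auto simp: points_on_def)
    moreover have "Y = (\<lambda>X\<in>Points Q4. h ` X) (k ` Y)"
      using Y ptk hk by (simp add: points_on_def Points_Q4)
    ultimately show "Y \<in> (\<lambda>X\<in>Points Q4. h ` X) ` points_on W" by blast
  qed
  have ts: "totally_singular (h ` W) \<and> vec.dim (h ` W) = 2"
    if h: "\<And>x y. h (x + y) = h x + h y" "\<And>k x. h (k *s x) = k *s h x"
      "\<And>x. parabolic_form (h x) = parabolic_form x" "\<And>x. k (h x) = x"
      and W: "totally_singular W" "vec.dim W = 2"
    for h k :: "'a ^ 5 \<Rightarrow> 'a ^ 5" and W
  proof -
    have sub: "vec.subspace W" using W by (simp add: totally_singular_def)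
    obtain x where x: "x \<in> W" "x \<noteq> 0" using dim_2_obtain_first[OF W(2)] .
    obtain y where y: "y \<in> W" "y \<notin> vec.span {x}" using dim_2_obtain_second[OF sub W(2)] .
    have "h 0 = 0" using h(2)[of 0 0] by simp
    then have hx: "h x \<noteq> 0" using x(2) h(4) by metis
    have hy: "h y \<notin> vec.span {h x}"
      using y(2) h(4) unfolding mem_span_1 h(2)[symmetric] by metis
    have "W = vec.span {x, y}" using span_pair_eq[OF sub W(2) x y] .
    moreover have "h ` vec.span {x, y} = vec.span {h x, h y}"
    proof (intro equalityI subsetI)
      fix z assume "z \<in> vec.span {h x, h y}"
      then obtain \<alpha> \<beta> where "z = h (\<alpha> *s x + \<beta> *s y)" by (auto simp: mem_span_2 h(1,2))
      moreover have "\<alpha> *s x + \<beta> *s y \<in> vec.span {x, y}" by (auto simp: mem_span_2)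
      ultimately show "z \<in> h ` vec.span {x, y}" by blast
    next
      fix z assume "z \<in> h ` vec.span {x, y}"
      then obtain \<alpha> \<beta> where "z = \<alpha> *s h x + \<beta> *s h y" by (auto simp: mem_span_2 h(1,2))
      then show "z \<in> vec.span {h x, h y}" unfolding mem_span_2 by blast
    qed
    ultimately have hW: "h ` W = vec.span {h x, h y}" by simp
    have "\<forall>z\<in>h ` W. parabolic_form z = 0" using W h(3) by (auto simp: totally_singular_def)
    then have "totally_singular (h ` W)" unfolding totally_singular_def hW by (simp add: vec.subspace_span)
    moreover have "vec.dim (h ` W) = 2" unfolding hW by (rule dim_span_pair[OF hx hy])
    ultimately show ?thesis by blast
  qed
  show img_f: "(\<lambda>X\<in>Points Q4. f ` X) ` points_on W = points_on (f ` W)" for W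
    using img[OF ptf ptg gfi] .
  have "(\<lambda>X\<in>Points Q4. f ` X) \<in> Bij (Points Q4)"
    unfolding Bij_def Points_Q4
    using ptf ptg bij_betw_byWitness[of Q4_points "\<lambda>X. g ` X" "\<lambda>X. f ` X" Q4_points]
    by (auto simp: gfi simp del: image_image)
  moreover have "(\<lambda>l. (\<lambda>X\<in>Points Q4. f ` X) ` l) ` Lines Q4 = Lines Q4"
  proof (intro equalityI subsetI)
    fix l assume "l \<in> (\<lambda>l. (\<lambda>X\<in>Points Q4. f ` X) ` l) ` Lines Q4"
    then obtain m where "m \<in> Lines Q4" "l = (\<lambda>X\<in>Points Q4. f ` X) ` m" by blast
    then obtain W where W: "totally_singular W" "vec.dim W = 2"
        "l = (\<lambda>X\<in>Points Q4. f ` X) ` points_on W"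
      by (auto simp: Lines_Q4)
    then show "l \<in> Lines Q4" unfolding Lines_Q4 W(3) img_f using ts[OF f gf W(1,2)] by blast
  next
    fix l :: "('a ^ 5) set set" assume "l \<in> Lines Q4"
    then obtain W where W: "totally_singular W" "vec.dim W = 2" "l = points_on W"
      by (auto simp: Lines_Q4)
    have "l = (\<lambda>X\<in>Points Q4. f ` X) ` points_on (g ` W)" unfolding img_f W(3) gfi ..
    moreover have "points_on (g ` W) \<in> Lines Q4" unfolding Lines_Q4 using ts[OF g fg W(1,2)] by blast
    ultimately show "l \<in> (\<lambda>l. (\<lambda>X\<in>Points Q4. f ` X) ` l) ` Lines Q4" by blast
  qed
  ultimately show "(\<lambda>X\<in>Points Q4. f ` X) \<in> automorphisms Q4"
    unfolding automorphisms_def by blast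
qed

text \<open>This is \<open>1 + c N\<close>, where \<open>N\<close> is the skew map attached to the
  bivector of \<open>a\<close> and \<open>b\<close>. When these span a totally singular space,
  \<open>N\<close> has square zero, so \<open>c\<close> parametrizes a one-parameter group.\<close>

definition siegel :: "'a::field ^ 5 \<Rightarrow> 'a ^ 5 \<Rightarrow> 'a \<Rightarrow> 'a ^ 5 \<Rightarrow> 'a ^ 5" where
  "siegel a b c x = x + c *s (polar_form x a *s b - polar_form x b *s a)"

definition siegel_map :: "'a::field ^ 5 \<Rightarrow> 'a ^ 5 \<Rightarrow> 'a \<Rightarrow> ('a ^ 5) set \<Rightarrow> ('a ^ 5) set" where
  "siegel_map a b c = (\<lambda>X\<in>Points Q4. siegel a b c ` X)"

context
  fixes a b :: "'a::field ^ 5"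
  assumes ab: "parabolic_form a = 0" "parabolic_form b = 0" "polar_form a b = 0"
begin

lemma polar_ab: "polar_form a a = 0" "polar_form b b = 0" "polar_form b a = 0"
  using ab polar_form_commute[of b a] by (simp_all add: polar_form_self)

lemma polar_siegel: "polar_form (siegel a b c x) a = polar_form x a"
  "polar_form (siegel a b c x) b = polar_form x b"
  using ab polar_ab by (simp_all add: siegel_def polar_simps polar_form_diff_left)

lemma siegel_add: "siegel a b c (x + y) = siegel a b c x + siegel a b c y"
  and siegel_scale: "siegel a b c (k *s x) = k *s siegel a b c x"
  by (simp_all add: siegel_def polar_simps vec_eq_iff algebra_simps)

text \<open>The displacement depends on \<open>x\<close> only through its products with
  \<open>a\<close> and \<open>b\<close>, which the map preserves; hence parameters add.\<close>

lemma siegel_siegel: "siegel a b c (siegel a b d x) = siegel a b (c + d) x"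
proof -
  have "siegel a b c (siegel a b d x)
      = siegel a b d x + c *s (polar_form x a *s b - polar_form x b *s a)"
    by (subst siegel_def) (simp only: polar_siegel)
  then show ?thesis by (simp add: siegel_def vec_eq_iff algebra_simps)
qed

lemma siegel_0: "siegel a b 0 x = x"
  by (simp add: siegel_def)

text \<open>The displacement is singular and orthogonal to \<open>x\<close>.\<close>

lemma parabolic_form_siegel: "parabolic_form (siegel a b c x) = parabolic_form x"
proof -
  have "parabolic_form (polar_form x a *s b - polar_form x b *s a) = 0"
    using ab polar_ab by (simp add: parabolic_form_diff parabolic_form_scale polar_simps)
  moreover have "polar_form x (polar_form x a *s b - polar_form x b *s a) = 0"
    by (simp add: polar_simps)
  ultimately show ?thesis
    by (simp only: siegel_def parabolic_form_add parabolic_form_scale polar_form_scale_right)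
      simp
qed

lemma siegel_inverse: "siegel a b (- c) (siegel a b c x) = x" "siegel a b c (siegel a b (- c) x) = x"
  by (simp_all add: siegel_siegel siegel_0)

lemmas siegel_isometry = isometry_automorphism[OF siegel_add siegel_scale parabolic_form_siegel
    siegel_add siegel_scale parabolic_form_siegel siegel_inverse]

text \<open>Perpendicularity to \<open>\<lambda> a + \<mu> b\<close> makes the displacement \<open>(z, a) b - (z, b) a\<close> proportional
  to that vector.\<close>

lemma siegel_displacement:
  assumes w: "w \<in> vec.span {a, b}" "w \<noteq> 0" and z: "polar_form z w = 0"
  obtains \<kappa> where "\<And>c. siegel a b c z = z + (c * \<kappa>) *s w"
    "\<kappa> = 0 \<Longrightarrow> polar_form z a = 0 \<and> polar_form z b = 0"
proof -
  obtain \<alpha> \<beta> where w': "w = \<alpha> *s a + \<beta> *s b" using w by (auto simp: mem_span_2)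
  have eq: "\<alpha> * polar_form z a + \<beta> * polar_form z b = 0" using z by (simp add: w' polar_simps)
  have "\<alpha> \<noteq> 0 \<or> \<beta> \<noteq> 0" using w w' by auto
  then show thesis
  proof
    assume \<alpha>: "\<alpha> \<noteq> 0"
    then have za: "polar_form z a = - (\<beta> * polar_form z b / \<alpha>)" using eq by (simp add: field_simps add_eq_0_iff)
    show thesis
    proof (rule that[of "- (polar_form z b / \<alpha>)"])
      show "siegel a b c z = z + (c * (- (polar_form z b / \<alpha>))) *s w" for c
        using \<alpha> by (simp add: siegel_def w' za vec_eq_iff field_simps)
      show "polar_form z a = 0 \<and> polar_form z b = 0" if "- (polar_form z b / \<alpha>) = 0"
        using that \<alpha> za by simp
    qed
  next
    assume \<beta>: "\<beta> \<noteq> 0"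
    then have zb: "polar_form z b = - (\<alpha> * polar_form z a / \<beta>)" using eq by (simp add: field_simps add_eq_0_iff2)
    show thesis
    proof (rule that[of "polar_form z a / \<beta>"])
      show "siegel a b c z = z + (c * (polar_form z a / \<beta>)) *s w" for c
        using \<beta> by (simp add: siegel_def w' zb vec_eq_iff field_simps)
      show "polar_form z a = 0 \<and> polar_form z b = 0" if "polar_form z a / \<beta> = 0"
        using that \<beta> zb by simp
    qed
  qed
qed

text \<open>A line meeting the axis in the point of \<open>w\<close> is orthogonal to
  \<open>w\<close>, so its vectors are displaced by multiples of \<open>w\<close> and stay in the
  same subspace.\<close>

lemma siegel_map_symmetry: "siegel_map a b c \<in> symmetries Q4 (points_on (vec.span {a, b}))"
proof -
  have "siegel_map a b c ` l = l"
    if l: "l \<in> Lines Q4" "l = points_on (vec.span {a, b}) \<or> l \<inter> points_on (vec.span {a, b}) \<noteq> {}" for l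
  proof -
    obtain W where W: "totally_singular W" "vec.dim W = 2" "l = points_on W"
      using l(1) by (auto simp: Lines_Q4)
    obtain X where X: "X \<in> l" "X \<in> points_on (vec.span {a, b})"
      using l Q4.third_point[OF l(1)] by blast
    obtain w where w: "w \<noteq> 0" "w \<in> vec.span {a, b}" "X = vec.span {w}"
      using points_onE[OF totally_singular_span_pair[OF ab] X(2)] .
    have wW: "w \<in> W" using span_mem_points_on[OF W(1) w(1)] w X W by simp
    have sub: "siegel a b c ` W \<subseteq> W" for c
    proof
      fix y assume "y \<in> siegel a b c ` W"
      then obtain z where z: "z \<in> W" "y = siegel a b c z" by blast
      obtain \<kappa> where "siegel a b c z = z + (c * \<kappa>) *s w"
        using siegel_displacement[OF w(2,1) totally_singular_polar[OF W(1) z(1) wW]] by metis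
      then show "y \<in> W"
        using z wW W(1) unfolding totally_singular_def
        by (metis vec.subspace_add vec.subspace_scale)
    qed
    have "z \<in> siegel a b c ` W" if "z \<in> W" for z
    proof
      show "z = siegel a b c (siegel a b (- c) z)" by (simp add: siegel_inverse)
      show "siegel a b (- c) z \<in> W" using sub that by blast
    qed
    then have "siegel a b c ` W = W" using sub by blast
    then show ?thesis
      unfolding siegel_map_def W(3) using siegel_isometry(2)[OF W(1,2)] by simp
  qed
  then show ?thesis
    using siegel_isometry(1) unfolding siegel_map_def symmetries_def line_perp_def by auto
qed

lemma siegel_map_commute:
  assumes "X \<in> Points Q4"
  shows "siegel_map a b c (siegel_map a b d X) = siegel_map a b d (siegel_map a b c X)"
proof -
  have "siegel_map a b c (siegel_map a b d X) = siegel a b (c + d) ` X" for c d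
  proof -
    have "siegel_map a b d X \<in> Points Q4"
      using Q4.aut_point[OF Q4.symmetriesD(1)[OF siegel_map_symmetry] assms] .
    then show ?thesis
      using assms by (simp add: siegel_map_def image_image siegel_siegel)
  qed
  then show ?thesis by (simp add: add.commute)
qed

text \<open>With \<open>w\<close> spanning the fixed point \<open>A\<close>, the vector
  \<open>x\<close> moves along the multiples of \<open>w\<close>. The rate \<kappa> is nonzero, as
  \<open>x\<close> would otherwise be orthogonal to the whole axis without lying in it.\<close>

lemma siegel_map_transitive:
  assumes a: "a \<noteq> 0" and b: "b \<notin> vec.span {a}"
    and V: "V \<in> Lines Q4" "V \<noteq> points_on (vec.span {a, b})"
    and A: "A \<in> V" "A \<in> points_on (vec.span {a, b})"
    and XY: "X \<in> V" "Y \<in> V" "X \<noteq> A" "Y \<noteq> A"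
  shows "\<exists>c. siegel_map a b c X = Y"
proof -
  let ?U = "vec.span {a, b}"
  note U = totally_singular_span_pair[OF ab] dim_span_pair[OF a b]
  obtain W where W: "totally_singular W" "vec.dim W = 2" "V = points_on W"
    using V(1) by (auto simp: Lines_Q4)
  have sub: "vec.subspace W" using W by (simp add: totally_singular_def)
  obtain w where w: "w \<noteq> 0" "w \<in> ?U" "A = vec.span {w}" using points_onE[OF U(1) A(2)] .
  have wW: "w \<in> W" using span_mem_points_on[OF W(1) w(1)] w A W by simp
  obtain x where x: "x \<noteq> 0" "x \<in> W" "parabolic_form x = 0" "X = vec.span {x}"
    using points_onE[OF W(1)] XY(1) W(3) by metis
  obtain y where y: "y \<noteq> 0" "y \<in> W" "parabolic_form y = 0" "Y = vec.span {y}"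
    using points_onE[OF W(1)] XY(2) W(3) by metis
  have xw: "x \<notin> vec.span {w}" using span_single_neq[OF w(1), of x] w x XY by auto
  have Wspan: "W = vec.span {w, x}" using span_pair_eq[OF sub W(2) wW w(1) x(2) xw] .
  have xU: "x \<notin> ?U"
  proof
    assume "x \<in> ?U"
    then have "?U = vec.span {w, x}"
      using span_pair_eq[OF vec.subspace_span U(2) w(2,1) _ xw] by blast
    then show False using V W Wspan by simp
  qed
  obtain \<kappa> where \<kappa>: "\<And>c. siegel a b c x = x + (c * \<kappa>) *s w"
    "\<kappa> = 0 \<Longrightarrow> polar_form x a = 0 \<and> polar_form x b = 0"
    using siegel_displacement[OF w(2,1) totally_singular_polar[OF W(1) x(2) wW]] by metis
  have \<kappa>0: "\<kappa> \<noteq> 0"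
  proof
    assume "\<kappa> = 0"
    moreover have "a \<in> ?U" "b \<in> ?U" by (auto intro: vec.span_base)
    ultimately show False
      using no_totally_singular_beyond_line[OF U xU x(3), of a b] \<kappa>(2) a b by blast
  qed
  obtain \<alpha> \<beta> where y': "y = \<alpha> *s w + \<beta> *s x" using y(2) unfolding Wspan mem_span_2 by blast
  have \<beta>0: "\<beta> \<noteq> 0"
  proof
    assume "\<beta> = 0"
    then have "y \<in> vec.span {w}" using y' by (auto simp: mem_span_1)
    then show False using span_single_neq[OF w(1), of y] w y XY by auto
  qed
  \<comment> \<open>Chosen so that \<beta> times the displacement of \<open>x\<close> is the
    component \<alpha> \<open>w\<close> of \<open>y\<close>.\<close>
  define c where "c = \<alpha> / (\<beta> * \<kappa>)"
  have "\<beta> *s siegel a b c x = y"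
    using \<beta>0 \<kappa>0 unfolding \<kappa>(1) c_def y' by (simp add: vec_eq_iff field_simps)
  then have "vec.span {siegel a b c x} = Y"
    using y \<beta>0 span_single_neq[of "siegel a b c x" y] by (auto simp: mem_span_1)
  moreover have "siegel_map a b c X = vec.span {siegel a b c x}"
    using Q4.line_subset[OF V(1)] XY(1) unfolding siegel_map_def x(4) vec.span_singleton
    by (auto simp: image_image siegel_scale)
  ultimately show ?thesis by blast
qed

end

theorem theorem7p12:
  fixes p h q :: nat
    and S :: "('a::{field,finite} ^ 5) set geometry"
    and U :: "('a ^ 5) set set"
    and u v :: "('a ^ 5) set"
  assumes "prime p" and "h \<ge> 1" and "q = p ^ h" and "odd q"
    and "CARD('a) = q"
    and "S = Q4"
    and "U \<in> Lines S"
    and "u \<in> Points S" and "u \<in> U"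
    and "v \<in> Points S" and "\<not> collinear_in S u v"
    and "L = symmetry_group S U"
    and "H = TGQ_kernel S u v \<inter> L"
  shows "subgroup H (Aut_group S) \<and>
         (\<exists>K. subgroup K (mult_of (residue_ring (int p))) \<and>
           (Aut_group S)\<lparr>carrier := H\<rparr> \<cong> (mult_of (residue_ring (int p)))\<lparr>carrier := K\<rparr>)"
proof -
  let ?G = "Aut_group S" and ?R = "mult_of (residue_ring (int p))"
  obtain W where W: "totally_singular W" "vec.dim W = 2" "U = points_on W"
    using assms(6,7) by (auto simp: Lines_Q4)
  have sub: "vec.subspace W" using W by (simp add: totally_singular_def)
  obtain a where a: "a \<in> W" "a \<noteq> 0" using dim_2_obtain_first[OF W(2)] .
  obtain b where b: "b \<in> W" "b \<notin> vec.span {a}" using dim_2_obtain_second[OF sub W(2)] .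
  have ab: "parabolic_form a = 0" "parabolic_form b = 0" "polar_form a b = 0"
    using W(1) a b totally_singular_polar by (auto simp: totally_singular_def)
  have U: "U = points_on (vec.span {a, b})"
    using span_pair_eq[OF sub W(2) a b] W(3) by simp
  have "TGQ_kernel Q4 u v \<inter> symmetry_group Q4 U = {\<one>\<^bsub>Aut_group Q4\<^esub>}"
  proof (rule Q4.kernel_Int_symmetry_group)
    show "U \<in> Lines Q4" "u \<in> U" "v \<in> Points Q4" "\<not> collinear_in Q4 u v"
      using assms(6,7,9,10,11) by simp_all
    show "range (siegel_map a b) \<subseteq> symmetries Q4 U"
      unfolding U using siegel_map_symmetry[OF ab] by blast
    show "s (t x) = t (s x)"
      if "s \<in> range (siegel_map a b)" "t \<in> range (siegel_map a b)" "x \<in> Points Q4" for s t x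
      using that(1,2) siegel_map_commute[OF ab that(3)] by auto
    show "\<exists>t\<in>range (siegel_map a b). t X = Y"
      if "V \<in> Lines Q4" "V \<noteq> U" "A \<in> V" "A \<in> U" "X \<in> V" "Y \<in> V" "X \<noteq> A" "Y \<noteq> A" for V A X Y
      using siegel_map_transitive[OF ab a(2) b(2) that(1) that(2)[unfolded U] that(3)
          that(4)[unfolded U] that(5-8)] by blast
  qed
  then have H: "H = {\<one>\<^bsub>?G\<^esub>}" using assms(6,12,13) by simp
  interpret G: group ?G unfolding \<open>S = Q4\<close> by (rule Q4.group_Aut_group)
  interpret R: residues_prime p "residue_ring (int p)"
    using \<open>prime p\<close> by unfold_locales simp_all
  interpret M: group ?R by (rule R.field_mult_group)
  \<comment> \<open>\<open>H\<close> is trivial, so the trivial subgroup serves as \<open>K\<close>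
    and the constant map is an isomorphism.\<close>
  have "(\<lambda>x. \<one>\<^bsub>?R\<^esub>) \<in> iso (?G\<lparr>carrier := H\<rparr>) (?R\<lparr>carrier := {\<one>\<^bsub>?R\<^esub>}\<rparr>)"
    unfolding H iso_def hom_def bij_betw_def by auto
  then have "?G\<lparr>carrier := H\<rparr> \<cong> ?R\<lparr>carrier := {\<one>\<^bsub>?R\<^esub>}\<rparr>"
    by (rule is_isoI)
  moreover have "subgroup {\<one>\<^bsub>?R\<^esub>} ?R" by (rule M.triv_subgroup)
  moreover have "subgroup H ?G" unfolding H by (rule G.triv_subgroup)
  ultimately show ?thesis by blast
qed

end
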